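(* Let $\nu,\mu\in\mathbb{C}$ with $\nu+\mu\notin-\mathbb{N}$ and $\nu+\frac12\notin\mathbb{Z}$. If $\pm\operatorname{Im}x>0$ (upper signs throughout when $\operatorname{Im}x>0$, lower signs throughout when $\operatorname{Im}x<0$), then $$\mathsf{Q}_\nu^\mu(x)=\sqrt{\pi}\,2^{-\nu-1}e^{\pm\frac12 i\pi(-\nu+\mu-1)}\left(\cos(\pi\mu)\mp i\frac{\sin(\pi(\mu-\nu))}{2\cos(\pi\nu)}\right)\frac{\Gamma(\nu+\mu+1)}{\Gamma(\nu+\frac32)}(1-x^2)^{-\frac12\nu-\frac12}{}_2F_1\!\left(\frac{\nu-\mu+1}{2},\frac{\nu+\mu+1}{2};\nu+\frac32;\frac{1}{1-x^2}\right)$$ $$+\,\pi^{\frac32}2^{\nu-1}\frac{e^{\pm\frac12 i\pi(\nu+\mu+1)}\sec(\pi\nu)}{\Gamma(\nu-\mu+1)\Gamma(\frac12-\nu)}(1-x^2)^{\frac12\nu}{}_2F_1\!\left(-\frac{\nu+\mu}{2},\frac{\mu-\nu}{2};\frac12-\nu;\frac{1}{1-x^2}\right).$$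
   Context: $\mathbb{N}=\{1,2,3,\dots\}$, $-\mathbb{N}=\{-1,-2,\dots\}$. $D_1=\mathbb{C}\setminus((-\infty,-1]\cup[1,\infty))$, $D_2=\mathbb{C}\setminus(-\infty,1]$. Complex powers are principal values. ${}_2F_1(a,b;c;w)$ is the Gauss hypergeometric function, principal branch on $\mathbb{C}\setminus[1,\infty)$ (the analytic continuation of $\sum_{n\ge0}\frac{(a)_n(b)_n}{(c)_n}\frac{w^n}{n!}$). $1/\Gamma$ is read as the entire function (zero at the poles of $\Gamma$). Associated Legendre function of the second kind: for $z\in D_2$, $\nu+\mu\in\mathbb{C}\setminus-\mathbb{N}$, $$Q_\nu^\mu(z)=\frac{\sqrt{\pi}\,e^{i\pi\mu}\Gamma(\nu+\mu+1)(z^2-1)^{\frac12\mu}}{2^{\nu+1}\Gamma(\nu+\frac32)z^{\nu+\mu+1}}\,{}_2F_1\!\left(\tfrac{\nu+\mu+2}{2},\tfrac{\nu+\mu+1}{2};\nu+\tfrac32;\tfrac1{z^2}\right),$$ where $(z^2-1)^\alpha:=(z+1)^\alpha(z-1)^\alpha$. Ferrers function of the second kind: for $x\in(-1,1)$, $$\mathsf{Q}_\nu^\mu(x)=\tfrac12\big[e^{-\frac12 i\pi\mu}\,e^{-i\pi\mu}Q_\nu^\mu(x+i0)+e^{\frac12 i\pi\mu}\,e^{-i\pi\mu}Q_\nu^\mu(x-i0)\big],$$ where $x\pm i0$ denotes the limit from the upper/lower half-plane, and $\mathsf{Q}_\nu^\mu$ is extended analytically to $D_1$. *)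

theory Defs
  imports "HOL-Complex_Analysis.Complex_Analysis"
begin

text \<open>
  The value at \<open>z\<close> of the analytic continuation to \<open>D\<close> of a function \<open>f\<close> given on \<open>S \<subseteq> D\<close>.
  If no holomorphic extension exists, or if \<open>z \<notin> D\<close>, nothing can be derived about this value.
\<close>
definition analytic_ext :: "complex set \<Rightarrow> complex set \<Rightarrow> (complex \<Rightarrow> complex) \<Rightarrow> complex \<Rightarrow> complex"
  where "analytic_ext D S f z =
    (THE v. \<exists>g. g holomorphic_on D \<and> (\<forall>w\<in>S. g w = f w) \<and> g z = v)"

lemma analytic_ext_eqI:
  assumes "g holomorphic_on D" "\<And>w. w \<in> S \<Longrightarrow> g w = f w"
    and "open D" "connected D" "S \<subseteq> D" "\<xi> \<in> D" "\<xi> islimpt S" "z \<in> D"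
  shows "analytic_ext D S f z = g z"
  unfolding analytic_ext_def
proof (rule the_equality)
  show "\<exists>h. h holomorphic_on D \<and> (\<forall>w\<in>S. h w = f w) \<and> h z = g z"
    using assms(1,2) by blast
next
  fix v assume "\<exists>h. h holomorphic_on D \<and> (\<forall>w\<in>S. h w = f w) \<and> h z = v"
  then obtain h where h: "h holomorphic_on D" "\<forall>w\<in>S. h w = f w" "h z = v" by blast
  have "h z - g z = 0"
  proof (rule analytic_continuation[of "\<lambda>w. h w - g w" D S \<xi> z])
    show "(\<lambda>w. h w - g w) holomorphic_on D"
      using h(1) assms(1) by (intro holomorphic_intros)
  qed (use h assms in auto)
  then show "v = g z" using h(3) by simp
qed

definition hyp2F1 :: "complex \<Rightarrow> complex \<Rightarrow> complex \<Rightarrow> complex \<Rightarrow> complex"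
  where "hyp2F1 a b c =
    analytic_ext (- (complex_of_real ` {1..})) (ball 0 1) (eval_fps (fps_hypergeo [a, b] [c] 1))"

lemma eval_fps_hypergeo_2_1:
  "eval_fps (fps_hypergeo [a, b] [c] 1) w =
     (\<Sum>n. pochhammer a n * pochhammer b n / pochhammer c n * w ^ n / fact n)"
  for a b c w :: complex
  by (simp add: eval_fps_def)

text \<open>
  Meant for \<open>z \<in> D\<^sub>2\<close>, the plane cut along \<open>(-\<infinity>, 1]\<close>, and \<open>\<nu> + \<mu> \<notin> {-1, -2, \<dots>}\<close>. The power
  of \<open>z\<^sup>2 - 1\<close> is the product of the principal powers of \<open>z + 1\<close> and \<open>z - 1\<close>. For \<open>\<nu> + 3/2\<close> a
  non-positive integer the hypergeometric factor has a singular parameter, and the formula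
  would have to be replaced by its limit in \<open>\<nu>\<close>; this is not done here.
\<close>
definition legendreQ :: "complex \<Rightarrow> complex \<Rightarrow> complex \<Rightarrow> complex"
  where "legendreQ \<nu> \<mu> z =
    of_real (sqrt pi) * exp (\<i> * pi * \<mu>) * Gamma (\<nu> + \<mu> + 1)
      * ((z + 1) powr (\<mu> / 2) * (z - 1) powr (\<mu> / 2))
    / (2 powr (\<nu> + 1) * z powr (\<nu> + \<mu> + 1)) * rGamma (\<nu> + 3/2)
    * hyp2F1 ((\<nu> + \<mu> + 2) / 2) ((\<nu> + \<mu> + 1) / 2) (\<nu> + 3/2) (1 / z\<^sup>2)"

text \<open>Limits at \<open>x\<close> from the open upper and lower half-planes.\<close>
definition lim_upper :: "(complex \<Rightarrow> complex) \<Rightarrow> complex \<Rightarrow> complex"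
  where "lim_upper f x = Lim (at x within {z. Im z > 0}) f"

definition lim_lower :: "(complex \<Rightarrow> complex) \<Rightarrow> complex \<Rightarrow> complex"
  where "lim_lower f x = Lim (at x within {z. Im z < 0}) f"

definition ferrersQ_interval :: "complex \<Rightarrow> complex \<Rightarrow> complex \<Rightarrow> complex"
  where "ferrersQ_interval \<nu> \<mu> x =
    1/2 * (exp (- (\<i> * pi * \<mu> / 2)) * exp (- (\<i> * pi * \<mu>)) * lim_upper (legendreQ \<nu> \<mu>) x
         + exp (\<i> * pi * \<mu> / 2) * exp (- (\<i> * pi * \<mu>)) * lim_lower (legendreQ \<nu> \<mu>) x)"

definition D1 :: "complex set"
  where "D1 = - (complex_of_real ` ({..-1} \<union> {1..}))"

definition ferrersQ :: "complex \<Rightarrow> complex \<Rightarrow> complex \<Rightarrow> complex"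
  where "ferrersQ \<nu> \<mu> =
    analytic_ext D1 (complex_of_real ` {-1<..<1}) (ferrersQ_interval \<nu> \<mu>)"

end

theory Submission
  imports Defs
begin

text \<open>
  Put \<open>a = (\<mu> - \<nu>)/2\<close> and \<open>b = (\<nu> + \<mu> + 1)/2\<close>. After division by \<open>(1 - x\<^sup>2)\<^bsup>\<mu>/2\<^esup>\<close> the Legendre equation
  becomes \<open>(1 - x\<^sup>2) v'' - (2 a + 2 b + 1) x v' = 4 a b v\<close>, which is the hypergeometric equation
  \<open>(a, b; 1/2)\<close> in \<open>y = x\<^sup>2\<close>. Pfaff's transformation turns \<open>Q\<close> on either half-plane into a constant
  times the Frobenius solution \<open>V\<close> at infinity, a hypergeometric function of \<open>1/(1 - x\<^sup>2)\<close>; exchanging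
  \<open>a\<close> and \<open>b\<close> (that is, \<open>\<nu> \<mapsto> -\<nu> - 1\<close>) gives the second function \<open>W\<close> of the theorem.

  On the unit disc \<open>V = A E \<plusminus> B O\<close> in the upper and lower half-disc, with \<open>E\<close>, \<open>O\<close> the even and odd
  power series solutions. The constants \<open>A\<close>, \<open>B\<close> are the limits of \<open>V\<close> and \<open>V'\<close> at \<open>0\<close> along the
  imaginary axis, where the argument of the hypergeometric function tends to \<open>1\<close>. So the
  boundary values of \<open>Q\<close> from both sides extend to the disc, and rewriting \<open>A E \<mp> B O\<close> in terms of \<open>V\<close>
  and \<open>W\<close> continues the Ferrers function into the half-planes.

  Every hypergeometric function to be continued has \<open>c - a - b = 1/2\<close> or \<open>a - b = \<plusminus>1/2\<close>. For these a quadratic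
  transformation expresses the continuation to the slit plane by a power series whose argument
  stays in the unit disc.
\<close>

section \<open>The hypergeometric equation\<close>

text \<open>The two derivatives are existential witnesses instead of iterates of
  \<open>deriv\<close>: a substitution can then be checked by supplying explicit formulas for them
  and verifying one algebraic identity.\<close>

definition hyp_sol :: "complex \<Rightarrow> complex \<Rightarrow> complex \<Rightarrow> complex set \<Rightarrow> (complex \<Rightarrow> complex) \<Rightarrow> bool"
  where "hyp_sol a b c D f \<longleftrightarrow> (\<exists>f1 f2. \<forall>z\<in>D.
    (f has_field_derivative f1 z) (at z) \<and> (f1 has_field_derivative f2 z) (at z) \<and>
    z * (1 - z) * f2 z + (c - (a + b + 1) * z) * f1 z = a * b * f z)"

lemma hyp_solI:
  assumes "\<And>z. z \<in> D \<Longrightarrow> (f has_field_derivative f1 z) (at z)"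
    and "\<And>z. z \<in> D \<Longrightarrow> (f1 has_field_derivative f2 z) (at z)"
    and "\<And>z. z \<in> D \<Longrightarrow> z * (1 - z) * f2 z + (c - (a + b + 1) * z) * f1 z = a * b * f z"
  shows "hyp_sol a b c D f"
  unfolding hyp_sol_def using assms by blast

lemma hyp_solE:
  assumes "hyp_sol a b c D f"
  obtains f1 f2 where "\<And>z. z \<in> D \<Longrightarrow> (f has_field_derivative f1 z) (at z)"
    and "\<And>z. z \<in> D \<Longrightarrow> (f1 has_field_derivative f2 z) (at z)"
    and "\<And>z. z \<in> D \<Longrightarrow> z * (1 - z) * f2 z + (c - (a + b + 1) * z) * f1 z = a * b * f z"
  using assms unfolding hyp_sol_def by blast

lemma hyp_sol_subset: "hyp_sol a b c D f \<Longrightarrow> E \<subseteq> D \<Longrightarrow> hyp_sol a b c E f"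
  unfolding hyp_sol_def by blast

lemma hyp_sol_commute: "hyp_sol a b c D f \<longleftrightarrow> hyp_sol b a c D f"
  unfolding hyp_sol_def by (simp add: ac_simps)

lemma hyp_sol_holomorphic: "hyp_sol a b c D f \<Longrightarrow> f holomorphic_on D"
  unfolding hyp_sol_def holomorphic_on_def
  by (meson field_differentiable_at_within field_differentiable_def)

section \<open>The Gauss series as the solution regular at 0\<close>

abbreviation hypF :: "complex \<Rightarrow> complex \<Rightarrow> complex \<Rightarrow> complex \<Rightarrow> complex"
  where "hypF a b c \<equiv> eval_fps (fps_hypergeo [a, b] [c] 1)"

lemma hypF_commute: "hypF a b c = hypF b a c"
proof -
  have "fps_hypergeo [a, b] [c] 1 = fps_hypergeo [b, a] [c] 1"
    by (rule fps_ext) (simp add: mult.commute)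
  then show ?thesis by simp
qed

lemma hypF_0: "hypF a b c 0 = 1"
  by (simp add: eval_fps_at_0)

lemma pochhammer_nonzero:
  fixes c :: complex
  assumes "c \<notin> \<int>\<^sub>\<le>\<^sub>0" shows "pochhammer c n \<noteq> 0" "c + of_nat n \<noteq> 0"
proof -
  show "pochhammer c n \<noteq> 0" using assms pochhammer_eq_0_imp_nonpos_Int by blast
  show "c + of_nat n \<noteq> 0" using assms
    by (metis add_eq_0_iff2 nonpos_Ints_of_int nonpos_Ints_def minus_of_nat_in_nonpos_Ints)
qed

lemma fps_hypergeo_2_1_rec:
  fixes a b c :: complex
  assumes "c \<notin> \<int>\<^sub>\<le>\<^sub>0"
  shows "of_nat (Suc n) * (c + of_nat n) * fps_nth (fps_hypergeo [a, b] [c] 1) (Suc n)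
     = (a + of_nat n) * (b + of_nat n) * fps_nth (fps_hypergeo [a, b] [c] 1) n"
  using pochhammer_nonzero(2)[OF assms, of n] unfolding fps_hypergeo_rec
  by (simp del: of_nat_Suc fps_hypergeo_nth)

text \<open>Comparison of coefficients. Read from right to left it shows that the Gauss series
  solves the equation, from left to right that the expansion of a solution holomorphic at 0 obeys
  the same recurrence.\<close>

lemma fps_hyp_ode_iff:
  fixes F :: "complex fps"
  defines "F1 \<equiv> fps_deriv F" and "F2 \<equiv> fps_deriv (fps_deriv F)"
  shows "fps_X * (1 - fps_X) * F2 + (fps_const c - fps_const (a + b + 1) * fps_X) * F1 - fps_const (a * b) * F = 0
    \<longleftrightarrow> (\<forall>n. of_nat (Suc n) * (c + of_nat n) * fps_nth F (Suc n) = (a + of_nat n) * (b + of_nat n) * fps_nth F n)"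
proof -
  let ?L = "fps_X * (1 - fps_X) * F2 + (fps_const c - fps_const (a + b + 1) * fps_X) * F1 - fps_const (a * b) * F"
  \<comment> \<open>All factors \<open>fps_X\<close> are moved to the front, where they only shift
    indices; the twofold shift is why n = 0 and n = 1 are treated separately.\<close>
  have L: "?L = fps_X * F2 - fps_X * (fps_X * F2) + fps_const c * F1 - fps_X * (fps_const (a + b + 1) * F1) - fps_const (a * b) * F"
    by (simp add: algebra_simps)
  have "fps_nth ?L n = of_nat (Suc n) * (c + of_nat n) * fps_nth F (Suc n) - (a + of_nat n) * (b + of_nat n) * fps_nth F n" for n
  proof (cases n)
    case 0
    then show ?thesis unfolding L by (simp add: F1_def F2_def)
  next
    case (Suc m)
    show ?thesis
    proof (cases m)
      case 0
      then show ?thesis using Suc unfolding L by (simp add: F1_def F2_def algebra_simps)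
    next
      case (Suc k)
      then show ?thesis using \<open>n = Suc m\<close> unfolding L by (simp add: F1_def F2_def algebra_simps)
    qed
  qed
  then show ?thesis by (simp add: fps_eq_iff del: of_nat_Suc)
qed

text \<open>Successive coefficients differ by the factor \<open>q n\<close>, which tends to 1; for r
  < 1 the ratio test works with \<open>k\<close>, the midpoint of r and 1. No coefficient is divided
  by, so terminating series are included.\<close>

lemma hypF_conv_radius:
  assumes "c \<notin> \<int>\<^sub>\<le>\<^sub>0"
  shows "fps_conv_radius (fps_hypergeo [a, b] [c] 1 :: complex fps) \<ge> 1"
  unfolding fps_conv_radius_def
proof (rule conv_radius_geI_ex')
  fix r :: real assume "0 < r" "ereal r < 1"
  hence r: "0 < r" "r < 1" by auto
  let ?h = "fps_nth (fps_hypergeo [a, b] [c] 1 :: complex fps)"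
  define q where "q n = (a + of_nat n) * (b + of_nat n) / (of_nat (Suc n) * (c + of_nat n))" for n
  have hq: "?h (Suc n) = q n * ?h n" for n
  proof -
    have "of_nat (Suc n) * (c + of_nat n) \<noteq> 0"
      using pochhammer_nonzero(2)[OF assms, of n] by (simp del: of_nat_Suc)
    then show ?thesis
      using fps_hypergeo_2_1_rec[OF assms, of n a b] unfolding q_def
      by (metis mult.commute nonzero_eq_divide_eq times_divide_eq_right)
  qed
  have "(\<lambda>n. (a / of_nat n + 1) * (b / of_nat n + 1) / ((1 / of_nat n + 1) * (c / of_nat n + 1))) \<longlonglongrightarrow> (0 + 1) * (0 + 1) / ((0 + 1) * (0 + 1))"
    by (intro tendsto_intros tendsto_divide_0[OF tendsto_const] tendsto_of_nat) auto
  moreover have "\<forall>\<^sub>F n in sequentially. (a / of_nat n + 1) * (b / of_nat n + 1) / ((1 / of_nat n + 1) * (c / of_nat n + 1)) = q n"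
    using eventually_gt_at_top[of 0]
  proof eventually_elim
    case (elim n)
    then have n: "of_nat n \<noteq> (0::complex)" by simp
    have "a / of_nat n + 1 = (a + of_nat n) / of_nat n" "b / of_nat n + 1 = (b + of_nat n) / of_nat n"
      "c / of_nat n + 1 = (c + of_nat n) / of_nat n" "1 / of_nat n + 1 = (of_nat (Suc n) :: complex) / of_nat n"
      using n by (simp_all add: field_simps)
    then show ?case unfolding q_def using n by (simp del: of_nat_Suc)
  qed
  ultimately have "q \<longlonglongrightarrow> 1" by (simp add: tendsto_cong)
  then have "(\<lambda>n. norm (q n) * r) \<longlonglongrightarrow> norm (1::complex) * r" by (intro tendsto_intros)
  moreover define k where "k = (1 + r) / 2"
  moreover have "norm (1::complex) * r < k" "k < 1" using r by (auto simp: k_def)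
  ultimately have "\<forall>\<^sub>F n in sequentially. norm (q n) * r < k" by (metis order_tendstoD(2))
  then obtain N where N: "\<And>n. n \<ge> N \<Longrightarrow> norm (q n) * r < k" by (auto simp: eventually_sequentially)
  show "summable (\<lambda>n. ?h n * of_real r ^ n)"
  proof (rule summable_ratio_test[OF \<open>k < 1\<close>])
    fix n assume "n \<ge> N"
    have "norm (?h (Suc n) * of_real r ^ Suc n) = (norm (q n) * r) * norm (?h n * of_real r ^ n)"
      using r unfolding hq by (simp add: norm_mult norm_power del: fps_hypergeo_nth)
    also have "\<dots> \<le> k * norm (?h n * of_real r ^ n)"
      using N[OF \<open>n \<ge> N\<close>] by (intro mult_right_mono) auto
    finally show "norm (?h (Suc n) * of_real r ^ Suc n) \<le> k * norm (?h n * of_real r ^ n)" .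
  qed
qed

lemma hyp_sol_hypF:
  assumes "c \<notin> \<int>\<^sub>\<le>\<^sub>0"
  shows "hyp_sol a b c (ball 0 1) (hypF a b c)"
proof -
  define F where "F = fps_hypergeo [a, b] [c] 1"
  have r: "fps_conv_radius F \<ge> 1" "fps_conv_radius (fps_deriv F) \<ge> 1" "fps_conv_radius (fps_deriv (fps_deriv F)) \<ge> 1"
    unfolding F_def using hypF_conv_radius[OF assms] fps_conv_radius_deriv order_trans by metis+
  have ode: "fps_X * (1 - fps_X) * fps_deriv (fps_deriv F) + (fps_const c - fps_const (a + b + 1) * fps_X) * fps_deriv F - fps_const (a * b) * F = 0"
    unfolding fps_hyp_ode_iff F_def using fps_hypergeo_2_1_rec[OF assms] by blast
  have "hyp_sol a b c (ball 0 1) (eval_fps F)"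
  proof (rule hyp_solI)
    fix z :: complex assume "z \<in> ball 0 1"
    then have z: "ereal (norm z) < 1" by simp
    have z': "ereal (norm z) < fps_conv_radius F" "ereal (norm z) < fps_conv_radius (fps_deriv F)"
       "ereal (norm z) < fps_conv_radius (fps_deriv (fps_deriv F))"
      using z r by (meson less_le_trans)+
    show "(eval_fps F has_field_derivative eval_fps (fps_deriv F) z) (at z)"
      by (rule has_field_derivative_eval_fps[OF z'(1)])
    show "(eval_fps (fps_deriv F) has_field_derivative eval_fps (fps_deriv (fps_deriv F)) z) (at z)"
      by (rule has_field_derivative_eval_fps[OF z'(2)])
    \<comment> \<open>\<open>eval_fps\<close> is known to respect sums and products within the radii
      of convergence. The polynomial coefficients have infinite radius, so z lies within the radius
      of every term.\<close>
    define P :: "complex fps" where "P = fps_X * (1 - fps_X)"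
    define Q :: "complex fps" where "Q = fps_const c - fps_const (a + b + 1) * fps_X"
    have X1: "fps_conv_radius (1 - fps_X :: complex fps) \<ge> \<infinity>"
      using fps_conv_radius_diff[of "1 :: complex fps" fps_X] by simp
    have cX: "fps_conv_radius (fps_const (a + b + 1) * fps_X :: complex fps) \<ge> \<infinity>"
      using fps_conv_radius_mult[of "fps_const (a + b + 1)" fps_X] by simp
    have P: "fps_conv_radius P \<ge> \<infinity>"
      using fps_conv_radius_mult[of fps_X "1 - fps_X :: complex fps"] X1 unfolding P_def by simp
    have Q: "fps_conv_radius Q \<ge> \<infinity>"
      using fps_conv_radius_diff[of "fps_const c" "fps_const (a + b + 1) * fps_X :: complex fps"] cX unfolding Q_def by simp
    have Pz: "eval_fps P z = z * (1 - z)" using X1 unfolding P_def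
      by (simp add: eval_fps_mult eval_fps_diff)
    have Qz: "eval_fps Q z = c - (a + b + 1) * z" using cX unfolding Q_def
      by (simp add: eval_fps_mult eval_fps_diff)
    have m1: "ereal (norm z) < fps_conv_radius (P * fps_deriv (fps_deriv F))"
      using fps_conv_radius_mult[of P "fps_deriv (fps_deriv F)"] P z'(3) by (auto simp: less_le_trans)
    have m2: "ereal (norm z) < fps_conv_radius (Q * fps_deriv F)"
      using fps_conv_radius_mult[of Q "fps_deriv F"] Q z'(2) by (auto simp: less_le_trans)
    have m3: "ereal (norm z) < fps_conv_radius (fps_const (a*b) * F)"
      using fps_conv_radius_mult[of "fps_const (a*b)" F] z'(1) by (auto simp: less_le_trans)
    have m12: "ereal (norm z) < fps_conv_radius (P * fps_deriv (fps_deriv F) + Q * fps_deriv F)"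
      using fps_conv_radius_add[of "P * fps_deriv (fps_deriv F)" "Q * fps_deriv F"] m1 m2 by (auto simp: less_le_trans min_def split: if_splits)
    have "0 = eval_fps (P * fps_deriv (fps_deriv F) + Q * fps_deriv F - fps_const (a * b) * F) z"
      using ode unfolding P_def Q_def by simp
    also have "\<dots> = eval_fps P z * eval_fps (fps_deriv (fps_deriv F)) z + eval_fps Q z * eval_fps (fps_deriv F) z - a * b * eval_fps F z"
      using m1 m2 m3 m12 z' P Q by (simp add: eval_fps_diff eval_fps_add eval_fps_mult)
    finally show "z * (1 - z) * eval_fps (fps_deriv (fps_deriv F)) z + (c - (a + b + 1) * z) * eval_fps (fps_deriv F) z = a * b * eval_fps F z"
      unfolding Pz Qz by simp
  qed
  then show ?thesis unfolding F_def .
qed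

text \<open>The Taylor coefficients of f obey the recurrence, and its leading factor (n + 1)(c + n)
  never vanishes because c is not a non-positive integer; hence \<open>f 0\<close> determines them
  all.\<close>

lemma hyp_sol_unique_at_0:
  assumes c: "c \<notin> \<int>\<^sub>\<le>\<^sub>0" and f: "hyp_sol a b c U f" and U: "open U" "0 \<in> U" and f0: "f 0 = 1"
  shows "\<forall>\<^sub>F z in nhds 0. f z = hypF a b c z"
proof -
  obtain f1 f2 where d: "\<And>z. z \<in> U \<Longrightarrow> (f has_field_derivative f1 z) (at z)"
    "\<And>z. z \<in> U \<Longrightarrow> (f1 has_field_derivative f2 z) (at z)"
    "\<And>z. z \<in> U \<Longrightarrow> z * (1 - z) * f2 z + (c - (a + b + 1) * z) * f1 z = a * b * f z"
    using hyp_solE[OF f] by metis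
  have hol: "f holomorphic_on U" using hyp_sol_holomorphic[OF f] .
  define F where "F = fps_expansion f 0"
  have F: "f has_fps_expansion F" unfolding F_def using hol U by (metis has_fps_expansion_fps_expansion)
  have df: "deriv f z = f1 z" if "z \<in> U" for z using d(1)[OF that] by (rule DERIV_imp_deriv)
  have ddf: "deriv (deriv f) z = f2 z" if "z \<in> U" for z
  proof -
    have "(deriv f has_field_derivative f2 z) (at z)"
      by (rule has_field_derivative_transform_within_open[OF d(2)[OF that] U(1) that]) (simp add: df)
    then show ?thesis by (rule DERIV_imp_deriv)
  qed
  let ?G = "fps_X * (1 - fps_X) * fps_deriv (fps_deriv F) + (fps_const c - fps_const (a + b + 1) * fps_X) * fps_deriv F - fps_const (a * b) * F"
  have "(\<lambda>z. z * (1 - z) * deriv (deriv f) z + (c - (a + b + 1) * z) * deriv f z - a * b * f z) has_fps_expansion ?G"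
    by (intro fps_expansion_intros F)
  moreover have "\<forall>\<^sub>F z in nhds 0. z * (1 - z) * deriv (deriv f) z + (c - (a + b + 1) * z) * deriv f z - a * b * f z = 0"
    using eventually_nhds_in_open[OF U] by eventually_elim (simp add: df ddf d(3))
  then have "(\<lambda>z. z * (1 - z) * deriv (deriv f) z + (c - (a + b + 1) * z) * deriv f z - a * b * f z) has_fps_expansion 0"
    unfolding has_fps_expansion_0_iff .
  ultimately have "?G = 0" using fps_expansion_unique_complex by blast
  then have rec: "of_nat (Suc n) * (c + of_nat n) * fps_nth F (Suc n) = (a + of_nat n) * (b + of_nat n) * fps_nth F n" for n
    unfolding fps_hyp_ode_iff by blast
  have "fps_nth F n = fps_nth (fps_hypergeo [a, b] [c] 1) n" for n
  proof (induction n)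
    case 0
    show ?case using has_fps_expansion_imp_0_eq_fps_nth_0[OF F] f0 by simp
  next
    case (Suc n)
    have "of_nat (Suc n) * (c + of_nat n) * fps_nth F (Suc n) = of_nat (Suc n) * (c + of_nat n) * fps_nth (fps_hypergeo [a, b] [c] 1) (Suc n)"
      unfolding rec fps_hypergeo_2_1_rec[OF c] Suc.IH ..
    moreover have "of_nat (Suc n) * (c + of_nat n) \<noteq> 0"
      using pochhammer_nonzero(2)[OF c, of n] by (simp del: of_nat_Suc)
    ultimately show ?case using mult_left_cancel by blast
  qed
  then have "F = fps_hypergeo [a, b] [c] 1" by (rule fps_ext)
  then show ?thesis using F unfolding has_fps_expansion_def by (auto elim: eventually_mono)
qed

section \<open>Transformations and continuation to the slit plane\<close>

text \<open>The equation keeps its form because z -> 1 - z exchanges its singular points 0 and 1 and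
  fixes infinity.\<close>

lemma hyp_sol_reflect:
  assumes f: "hyp_sol a b c D f" and D: "\<And>z. z \<in> E \<Longrightarrow> 1 - z \<in> D"
  shows "hyp_sol a b (a + b - c + 1) E (\<lambda>z. f (1 - z))"
proof -
  obtain f1 f2 where d: "\<And>z. z \<in> D \<Longrightarrow> (f has_field_derivative f1 z) (at z)"
    "\<And>z. z \<in> D \<Longrightarrow> (f1 has_field_derivative f2 z) (at z)"
    "\<And>z. z \<in> D \<Longrightarrow> z * (1 - z) * f2 z + (c - (a + b + 1) * z) * f1 z = a * b * f z"
    using hyp_solE[OF f] by metis
  show ?thesis
  proof (rule hyp_solI)
    fix z assume z: "z \<in> E"
    have du: "((\<lambda>z. 1 - z) has_field_derivative - 1) (at z)"
      by (auto intro!: derivative_eq_intros)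
    show "((\<lambda>z. f (1 - z)) has_field_derivative - f1 (1 - z)) (at z)"
      using DERIV_chain2[OF d(1)[OF D[OF z]] du] by simp
    show "((\<lambda>z. - f1 (1 - z)) has_field_derivative f2 (1 - z)) (at z)"
      using DERIV_minus[OF DERIV_chain2[OF d(2)[OF D[OF z]] du]] by simp
    show "z * (1 - z) * f2 (1 - z) + (a + b - c + 1 - (a + b + 1) * z) * - f1 (1 - z) = a * b * f (1 - z)"
      using d(3)[OF D[OF z]] by (simp add: algebra_simps)
  qed
qed

text \<open>The map z/(z - 1) fixes 0 and exchanges 1 and infinity; the power of 1 - z makes 0 an
  exponent at 1 again. Taking arbitrary solutions instead of the series allows the transformation to
  be iterated and applied to continuations.\<close>

lemma hyp_sol_pfaff:
  assumes f: "hyp_sol a (c - b) c D f"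
    and D: "\<And>z. z \<in> E \<Longrightarrow> 1 - z \<notin> \<real>\<^sub>\<le>\<^sub>0" "\<And>z. z \<in> E \<Longrightarrow> z / (z - 1) \<in> D"
  shows "hyp_sol a b c E (\<lambda>z. (1 - z) powr (- a) * f (z / (z - 1)))"
proof -
  obtain f1 f2 where d: "\<And>z. z \<in> D \<Longrightarrow> (f has_field_derivative f1 z) (at z)"
    "\<And>z. z \<in> D \<Longrightarrow> (f1 has_field_derivative f2 z) (at z)"
    "\<And>z. z \<in> D \<Longrightarrow> z * (1 - z) * f2 z + (c - (a + (c - b) + 1) * z) * f1 z = a * (c - b) * f z"
    using hyp_solE[OF f] by metis
  let ?P = "\<lambda>z::complex. (1 - z) powr (- a)" and ?w = "\<lambda>z::complex. z / (z - 1)"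
  show ?thesis
  proof (rule hyp_solI)
    fix z assume z: "z \<in> E"
    have nz: "1 - z \<noteq> 0" "z - 1 \<noteq> 0" using D(1)[OF z] by auto
    have dw: "(?w has_field_derivative - 1 / (1 - z)\<^sup>2) (at z)"
      using DERIV_divide[OF DERIV_ident DERIV_diff[OF DERIV_ident DERIV_const[of 1]] nz(2)]
      by (simp add: power2_eq_square power2_commute[of 1 z, unfolded power2_eq_square])
    have dP: "(?P has_field_derivative ?P z * a / (1 - z)) (at z)"
      using D(1)[OF z] nz by (auto intro!: derivative_eq_intros simp: powr_diff powr_minus_divide)
    note df = DERIV_chain2[OF d(1)[OF D(2)[OF z]] dw] and df1 = DERIV_chain2[OF d(2)[OF D(2)[OF z]] dw]
    have du: "((\<lambda>z. 1 - z) has_field_derivative - 1) (at z)"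
      by (auto intro!: derivative_eq_intros)
    \<comment> \<open>Every denominator is a power of u; with the values of f, f1 and f2 named, the
      remaining claims become polynomial identities once denominators are cleared.\<close>
    define u where "u = 1 - z"
    define g g1 g2 P where "g = f (?w z)" and "g1 = f1 (?w z)" and "g2 = f2 (?w z)" and "P = ?P z"
    have u: "u \<noteq> 0" "z = 1 - u" "?w z = (u - 1) / u" using nz by (auto simp: u_def divide_simps algebra_simps)
    show "((\<lambda>z. ?P z * f (?w z)) has_field_derivative ?P z * (a * f (?w z) / (1 - z) - f1 (?w z) / (1 - z)\<^sup>2)) (at z)"
      using DERIV_mult[OF dP df] by (simp add: algebra_simps)
    show "((\<lambda>z. ?P z * (a * f (?w z) / (1 - z) - f1 (?w z) / (1 - z)\<^sup>2)) has_field_derivative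
       ?P z * (a * (a + 1) * f (?w z) / (1 - z)^2 - (2 * a + 2) * f1 (?w z) / (1 - z)^3 + f2 (?w z) / (1 - z)^4)) (at z)"
      apply (rule DERIV_cong)
       apply (rule DERIV_mult[OF dP DERIV_diff[OF DERIV_divide[OF DERIV_cmult[OF df] du nz(1)] DERIV_divide[OF df1 DERIV_power[OF du]]]])
      using nz(1) apply simp
      unfolding u_def[symmetric] g_def[symmetric] g1_def[symmetric] g2_def[symmetric] P_def[symmetric]
      using u(1) apply (simp add: divide_simps)
      apply algebra
      done
    have "(u - 1) / u * (1 - (u - 1) / u) * g2 + (c - (a + (c - b) + 1) * ((u - 1) / u)) * g1 = a * (c - b) * g"
      using d(3)[OF D(2)[OF z]] unfolding u(3) g_def g1_def g2_def by simp
    moreover have "(u - 1) * g2 + (c * u - (a + (c - b) + 1) * (u - 1)) * u * g1 - a * (c - b) * u^2 * g =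
      u^2 * ((u - 1) / u * (1 - (u - 1) / u) * g2 + (c - (a + (c - b) + 1) * ((u - 1) / u)) * g1 - a * (c - b) * g)"
      using u(1) by (simp add: divide_simps) algebra
    ultimately have e: "(u - 1) * g2 + (c * u - (a + (c - b) + 1) * (u - 1)) * u * g1 - a * (c - b) * u^2 * g = 0"
      by simp
    \<comment> \<open>The transformed equation is the original one, cleared of denominators, times -
      P / u^3.\<close>
    have "(1 - u) * u * (P * (a * (a + 1) * g / u^2 - (2 * a + 2) * g1 / u^3 + g2 / u^4)) +
      (c - (a + b + 1) * (1 - u)) * (P * (a * g / u - g1 / u\<^sup>2)) - a * b * (P * g) =
      - P / u^3 * ((u - 1) * g2 + (c * u - (a + (c - b) + 1) * (u - 1)) * u * g1 - a * (c - b) * u^2 * g)"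
      using u(1) by (simp add: divide_simps) algebra
    then show "z * (1 - z) * (?P z * (a * (a + 1) * f (?w z) / (1 - z)^2 - (2 * a + 2) * f1 (?w z) / (1 - z)^3 + f2 (?w z) / (1 - z)^4)) +
      (c - (a + b + 1) * z) * (?P z * (a * f (?w z) / (1 - z) - f1 (?w z) / (1 - z)\<^sup>2)) = a * b * (?P z * f (?w z))"
      unfolding e g_def[symmetric] g1_def[symmetric] g2_def[symmetric] P_def[symmetric]
      unfolding u_def[symmetric] using u(2) by simp
  qed
qed

text \<open>The substitution \<open>z = 4 t (1 - t)\<close>, solved for \<open>t\<close>.\<close>
lemma hyp_sol_quadratic:
  assumes f: "hyp_sol (2 * a) (2 * b) c D f" and c: "c = a + b + 1/2"
    and D: "\<And>z. z \<in> E \<Longrightarrow> 1 - z \<notin> \<real>\<^sub>\<le>\<^sub>0" "\<And>z. z \<in> E \<Longrightarrow> (1 - csqrt (1 - z)) / 2 \<in> D"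
  shows "hyp_sol a b c E (\<lambda>z. f ((1 - csqrt (1 - z)) / 2))"
proof -
  obtain f1 f2 where d: "\<And>z. z \<in> D \<Longrightarrow> (f has_field_derivative f1 z) (at z)"
    "\<And>z. z \<in> D \<Longrightarrow> (f1 has_field_derivative f2 z) (at z)"
    "\<And>z. z \<in> D \<Longrightarrow> z * (1 - z) * f2 z + (c - (2 * a + 2 * b + 1) * z) * f1 z = 2 * a * (2 * b) * f z"
    using hyp_solE[OF f] by metis
  let ?t = "\<lambda>z::complex. (1 - csqrt (1 - z)) / 2"
  show ?thesis
  proof (rule hyp_solI)
    fix z assume z: "z \<in> E"
    define s where "s = csqrt (1 - z)"
    have nz: "s \<noteq> 0" "csqrt (1 - z) \<noteq> 0" using D(1)[OF z] by (auto simp: s_def)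
    have ds: "((\<lambda>z. csqrt (1 - z)) has_field_derivative - 1 / (2 * csqrt (1 - z))) (at z)"
      using D(1)[OF z] by (auto intro!: derivative_eq_intros simp: field_simps)
    have dt: "(?t has_field_derivative 1 / (4 * csqrt (1 - z))) (at z)"
      by (rule derivative_eq_intros ds refl | simp)+
    note df = DERIV_chain2[OF d(1)[OF D(2)[OF z]] dt] and df1 = DERIV_chain2[OF d(2)[OF D(2)[OF z]] dt]
    show "((\<lambda>z. f (?t z)) has_field_derivative f1 (?t z) / (4 * csqrt (1 - z))) (at z)"
      using df by simp
    show "((\<lambda>z. f1 (?t z) / (4 * csqrt (1 - z))) has_field_derivative
      f2 (?t z) / (16 * csqrt (1 - z) ^ 2) + f1 (?t z) / (8 * csqrt (1 - z) ^ 3)) (at z)"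
      apply (rule DERIV_cong)
       apply (rule DERIV_divide[OF df1 DERIV_cmult[OF ds]])
      using nz(2) apply simp
      unfolding s_def[symmetric]
      using nz(1) apply (simp add: divide_simps)
      apply algebra
      done
    define g g1 g2 where "g = f (?t z)" and "g1 = f1 (?t z)" and "g2 = f2 (?t z)"
    have z: "z = 1 - s^2" unfolding s_def by simp
    have e: "(1 - s) / 2 * (1 - (1 - s) / 2) * g2 + (c - (2 * a + 2 * b + 1) * ((1 - s) / 2)) * g1 = 2 * a * (2 * b) * g"
      using d(3)[OF D(2)[OF \<open>z \<in> E\<close>]] unfolding g_def g1_def g2_def s_def .
    \<comment> \<open>With t = (1 - s)/2 one has 4 t (1 - t) = 1 - s^2. The terms in 1/s cancel
      because c = a + b + 1/2, and one quarter of the equation of f remains.\<close>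
    have "(1 - s^2) * s^2 * (g2 / (16 * s^2) + g1 / (8 * s^3)) + (c - (a + b + 1) * (1 - s^2)) * (g1 / (4 * s)) - a * b * g
      = ((1 - s) / 2 * (1 - (1 - s) / 2) * g2 + (c - (2 * a + 2 * b + 1) * ((1 - s) / 2)) * g1 - 2 * a * (2 * b) * g) / 4"
      unfolding c using nz(1) by (simp add: divide_simps) algebra
    then have "(1 - s^2) * s^2 * (g2 / (16 * s^2) + g1 / (8 * s^3)) + (c - (a + b + 1) * (1 - s^2)) * (g1 / (4 * s)) = a * b * g"
      unfolding e by simp
    moreover have "1 - z = s^2" unfolding z by simp
    ultimately show "z * (1 - z) * (f2 (?t z) / (16 * csqrt (1 - z) ^ 2) + f1 (?t z) / (8 * csqrt (1 - z) ^ 3)) +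
      (c - (a + b + 1) * z) * (f1 (?t z) / (4 * csqrt (1 - z))) = a * b * f (?t z)"
      unfolding g_def[symmetric] g1_def[symmetric] g2_def[symmetric]
      unfolding s_def[symmetric] using z by simp
  qed
qed

lemma hyp_sol_eq_hypF:
  assumes "c \<notin> \<int>\<^sub>\<le>\<^sub>0" "hyp_sol a b c (ball 0 1) f" "f 0 = 1" "norm z < 1"
  shows "f z = hypF a b c z"
proof -
  have "\<forall>\<^sub>F z in nhds 0. f z = hypF a b c z"
    by (rule hyp_sol_unique_at_0[OF assms(1,2)]) (use assms in auto)
  then obtain S where S: "open S" "0 \<in> S" "\<And>z. z \<in> S \<Longrightarrow> f z = hypF a b c z"
    unfolding eventually_nhds by blast
  show ?thesis
  proof (rule analytic_continuation_open[of "S \<inter> ball 0 1" "ball 0 1" f "hypF a b c" z])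
    show "f holomorphic_on ball 0 1" "hypF a b c holomorphic_on ball 0 1"
      using hyp_sol_holomorphic assms(2) hyp_sol_hypF[OF assms(1)] by blast+
  qed (use S assms(4) in auto)
qed

section \<open>The principal branch on the slit plane\<close>

definition slit_plane :: "complex set" where "slit_plane = - (complex_of_real ` {1..})"

lemma slit_plane_iff: "z \<in> slit_plane \<longleftrightarrow> 1 - z \<notin> \<real>\<^sub>\<le>\<^sub>0"
proof -
  have "z \<in> complex_of_real ` {1..} \<longleftrightarrow> Im z = 0 \<and> Re z \<ge> 1"
    by (auto simp: image_iff complex_eq_iff intro!: bexI[of _ "Re z"])
  then show ?thesis by (auto simp: slit_plane_def complex_nonpos_Reals_iff)
qed

lemma open_slit_plane: "open slit_plane"
proof -
  have "closed (complex_of_real ` {1..})"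
    by (intro closed_injective_linear_image) (auto simp: linear_of_real inj_on_def)
  then show ?thesis by (simp add: slit_plane_def open_Compl)
qed

lemma connected_slit_plane: "connected slit_plane"
proof -
  have "starlike slit_plane"
    unfolding starlike_def
  proof (intro bexI ballI subsetI)
    fix x y :: complex assume x: "x \<in> slit_plane" and y: "y \<in> closed_segment 0 x"
    obtain u where u: "0 \<le> u" "u \<le> 1" "y = of_real u * x"
      using y by (auto simp: in_segment scaleR_conv_of_real)
    show "y \<in> slit_plane"
    proof (cases "Im x = 0")
      case True
      then have "Re x < 1" using x by (auto simp: slit_plane_iff complex_nonpos_Reals_iff)
      then have "u * Re x < 1" using u by (cases "Re x \<le> 0") (smt (verit) mult_nonneg_nonpos mult_left_le_one_le)+
      then show ?thesis using True u by (auto simp: slit_plane_iff complex_nonpos_Reals_iff)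
    next
      case False
      then show ?thesis using u by (cases "u = 0") (auto simp: slit_plane_iff complex_nonpos_Reals_iff)
    qed
  qed (auto simp: slit_plane_iff complex_nonpos_Reals_iff)
  then show ?thesis by (rule starlike_imp_connected)
qed

lemma ball_subset_slit_plane: "ball 0 1 \<subseteq> slit_plane"
proof
  fix z :: complex assume "z \<in> ball 0 1"
  then show "z \<in> slit_plane"
    using complex_Re_le_cmod[of z] by (auto simp: slit_plane_iff complex_nonpos_Reals_iff)
qed

lemma pfaff_mem_slit_plane: "z \<in> slit_plane \<Longrightarrow> z / (z - 1) \<in> slit_plane"
proof -
  assume z: "z \<in> slit_plane"
  then have nz: "1 - z \<noteq> 0" by (auto simp: slit_plane_iff)
  have "1 - z / (z - 1) = inverse (1 - z)" using nz by (simp add: divide_simps)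
  then show ?thesis using z unfolding slit_plane_iff by (simp add: nonpos_Reals_inverse_iff)
qed

text \<open>\<open>hyp2F1\<close> is a definite description and yields nothing until some extension
  is known to exist. A solution on the slit plane with value 1 at 0 is one, since it agrees with the
  series on the disc by uniqueness at 0.\<close>

lemma hyp2F1_eqI:
  assumes "c \<notin> \<int>\<^sub>\<le>\<^sub>0" "hyp_sol a b c slit_plane f" "f 0 = 1" "z \<in> slit_plane"
  shows "hyp2F1 a b c z = f z"
  unfolding hyp2F1_def slit_plane_def[symmetric]
proof (rule analytic_ext_eqI)
  show "f holomorphic_on slit_plane" by (rule hyp_sol_holomorphic[OF assms(2)])
  show "f w = hypF a b c w" if "w \<in> ball 0 1" for w
    using that by (intro hyp_sol_eq_hypF[OF assms(1) hyp_sol_subset[OF assms(2) ball_subset_slit_plane] assms(3)]) auto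
  show "0 \<in> slit_plane" using ball_subset_slit_plane by force
  show "(0::complex) islimpt ball 0 1" by (simp add: islimpt_ball)
qed (use open_slit_plane connected_slit_plane ball_subset_slit_plane assms(4) in auto)

lemma hyp_sol_cong:
  assumes "hyp_sol a b c D f" "open D" "\<And>z. z \<in> D \<Longrightarrow> g z = f z"
  shows "hyp_sol a b c D g"
proof -
  obtain f1 f2 where d: "\<And>z. z \<in> D \<Longrightarrow> (f has_field_derivative f1 z) (at z)"
    "\<And>z. z \<in> D \<Longrightarrow> (f1 has_field_derivative f2 z) (at z)"
    "\<And>z. z \<in> D \<Longrightarrow> z * (1 - z) * f2 z + (c - (a + b + 1) * z) * f1 z = a * b * f z"
    using hyp_solE[OF assms(1)] by metis
  show ?thesis
  proof (rule hyp_solI)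
    fix z assume z: "z \<in> D"
    show "(g has_field_derivative f1 z) (at z)"
      by (rule has_field_derivative_transform_within_open[OF d(1)[OF z] assms(2) z]) (simp add: assms(3))
  qed (use d assms(3) in auto)
qed

text \<open>The assumption says that t is nearer to 0 than to 1.\<close>

lemma norm_pfaff_less_1:
  assumes "Re t < 1/2" shows "norm (t / (t - 1)) < 1" "1 - t \<notin> \<real>\<^sub>\<le>\<^sub>0"
proof -
  have "t - 1 \<noteq> 0" using assms by auto
  moreover have "(norm t)\<^sup>2 < (norm (t - 1))\<^sup>2"
    using assms unfolding cmod_power2 by (simp add: power2_eq_square algebra_simps)
  then have "norm t < norm (t - 1)" using power2_less_imp_less norm_ge_zero by blast
  ultimately show "norm (t / (t - 1)) < 1" by (simp add: norm_divide)
  show "1 - t \<notin> \<real>\<^sub>\<le>\<^sub>0" using assms by (simp add: complex_nonpos_Reals_iff)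
qed

lemma Re_csqrt_pos:
  assumes "z \<notin> \<real>\<^sub>\<le>\<^sub>0" shows "Re (csqrt z) > 0"
proof (rule ccontr)
  define w where "w = csqrt z"
  have z: "z = w\<^sup>2" by (simp add: w_def)
  assume "\<not> Re (csqrt z) > 0"
  then have "Re w = 0" using csqrt_principal[of z] by (auto simp: w_def)
  then show False using assms unfolding z by (simp add: complex_nonpos_Reals_iff power2_eq_square)
qed

lemma hyp2F1_sol:
  assumes c: "c \<notin> \<int>\<^sub>\<le>\<^sub>0" "c = a + b + 1/2"
  shows "hyp_sol a b c slit_plane (hyp2F1 a b c)"
    and "norm w < 1 \<Longrightarrow> hyp2F1 a b c w = hypF a b c w"
proof -
  \<comment> \<open>The roots \<open>t = (1 - \<surd>(1 - z))/2\<close> fill the half-plane \<open>Re t < 1/2\<close>, which \<open>t/(t - 1)\<close> maps into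
    the unit disc.\<close>
  define G where "G t = (1 - t) powr (- (2 * a)) * hypF (2 * a) (c - 2 * b) c (t / (t - 1))" for t
  have G: "hyp_sol (2 * a) (2 * b) c {t. Re t < 1/2} G"
    unfolding G_def by (rule hyp_sol_pfaff[OF hyp_sol_hypF[OF c(1)]]) (use norm_pfaff_less_1 in auto)
  define f where "f z = G ((1 - csqrt (1 - z)) / 2)" for z
  have f: "hyp_sol a b c slit_plane f"
    unfolding f_def by (rule hyp_sol_quadratic[OF G c(2)]) (use Re_csqrt_pos in \<open>auto simp: slit_plane_iff simp del: csqrt.sel\<close>)
  have f0: "f 0 = 1" by (simp add: f_def G_def hypF_0)
  show *: "hyp_sol a b c slit_plane (hyp2F1 a b c)"
    by (rule hyp_sol_cong[OF f open_slit_plane hyp2F1_eqI[OF c(1) f f0]])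
  show "hyp2F1 a b c w = hypF a b c w" if "norm w < 1"
    using hyp2F1_eqI[OF c(1) f f0, of w] hyp_sol_eq_hypF[OF c(1) hyp_sol_subset[OF f ball_subset_slit_plane] f0 that]
      ball_subset_slit_plane that by force
qed

text \<open>Here c - b = a + 1/2, so Pfaff's transformation carries the known continuation for c = a
  + b + 1/2 over to upper parameters differing by 1/2, the class of the function in
  \<open>legendreQ\<close>. Both sides are 1 at 0.\<close>

lemma hyp2F1_pfaff:
  assumes c: "c \<notin> \<int>\<^sub>\<le>\<^sub>0" "c = a + b + 1/2" and z: "z \<in> slit_plane"
  shows "hyp2F1 (a + 1/2) a c z = (1 - z) powr (- a) * hyp2F1 a b c (z / (z - 1))"
proof -
  have "hyp_sol a (c - (a + 1/2)) c slit_plane (hyp2F1 a b c)"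
    using hyp2F1_sol(1)[OF c] c(2) by simp
  then have "hyp_sol a (a + 1/2) c slit_plane (\<lambda>z. (1 - z) powr (- a) * hyp2F1 a b c (z / (z - 1)))"
    by (rule hyp_sol_pfaff) (use pfaff_mem_slit_plane in \<open>auto simp: slit_plane_iff\<close>)
  then show ?thesis
    by (intro hyp2F1_eqI[OF c(1) _ _ z]) (auto simp: hyp2F1_sol(2)[OF c] hypF_0 hyp_sol_commute)
qed

lemma hypF_euler:
  assumes c: "c \<notin> \<int>\<^sub>\<le>\<^sub>0" and z: "norm z < 1"
  shows "hypF a b c z = (1 - z) powr (c - a - b) * hypF (c - a) (c - b) c z"
proof -
  \<comment> \<open>Euler's transformation is Pfaff's transformation applied twice.\<close>
  define f where "f z = (1 - z) powr (- (c - b)) * hypF (c - a) (c - b) c (z / (z - 1))" for z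
  have "hyp_sol (c - b) (c - a) c (ball 0 1) (hypF (c - a) (c - b) c)"
    using hyp_sol_hypF[OF c] hyp_sol_commute by blast
  then have f: "hyp_sol (c - b) a c {z. Re z < 1/2} f"
    unfolding f_def by (rule hyp_sol_pfaff) (use norm_pfaff_less_1 in auto)
  define g where "g z = (1 - z) powr (- a) * f (z / (z - 1))" for z
  \<comment> \<open>The inner Pfaff step is valid for Re < 1/2. The unit disc is mapped into that
    half-plane by z/(z - 1), so the outer step reaches the whole disc.\<close>
  have re: "Re (z / (z - 1)) < 1/2" "1 - z \<notin> \<real>\<^sub>\<le>\<^sub>0" "z \<noteq> 1" if "norm z < 1" for z
  proof -
    show "z \<noteq> 1" using that by auto
    have "(norm z)\<^sup>2 < 1" using that by (simp add: abs_square_less_1)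
    then have "2 * (Re z * (Re z - 1) + Im z * Im z) < (Re z - 1)\<^sup>2 + (Im z)\<^sup>2"
      unfolding cmod_power2 by (simp add: power2_eq_square algebra_simps)
    moreover have "(Re z - 1)\<^sup>2 + (Im z)\<^sup>2 > 0" using \<open>z \<noteq> 1\<close>
      by (metis Im_complex_of_real Re_complex_of_real complex_eqI diff_eq_eq add_0 of_real_1 one_complex.simps sum_power2_gt_zero_iff)
    ultimately show "Re (z / (z - 1)) < 1/2" by (simp add: Re_divide divide_simps)
    show "1 - z \<notin> \<real>\<^sub>\<le>\<^sub>0" using that complex_Re_le_cmod[of z] by (auto simp: complex_nonpos_Reals_iff)
  qed
  have "hyp_sol a b c (ball 0 1) g"
    unfolding g_def by (rule hyp_sol_pfaff[of _ _ _ "{z. Re z < 1/2}"]) (use f hyp_sol_commute re in auto)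
  then have "g z = hypF a b c z"
    by (rule hyp_sol_eq_hypF[OF c]) (use z in \<open>auto simp: g_def f_def hypF_0\<close>)
  moreover have "g z = (1 - z) powr (c - a - b) * hypF (c - a) (c - b) c z"
  proof -
    have u: "1 - z / (z - 1) = inverse (1 - z)" "z / (z - 1) / (z / (z - 1) - 1) = z"
      using re(3)[OF z] by (simp_all add: divide_simps)
    have "inverse (1 - z) powr (- (c - b)) = (1 - z) powr (c - b)"
      using re(2)[OF z] re(3)[OF z] by (simp add: powr_def Ln_inverse algebra_simps)
    moreover have "(1 - z) powr (c - a - b) = (1 - z) powr (- a) * (1 - z) powr (c - b)"
      by (simp add: powr_add[symmetric] algebra_simps)
    ultimately show ?thesis unfolding g_def f_def u by simp
  qed
  ultimately show ?thesis by simp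
qed

section \<open>Behaviour at the singular point 1\<close>

text \<open>From some index N on, \<open>a n - L * b n\<close> is small relative to
  \<open>b n\<close>. The first N terms contribute at most the constant \<open>C\<close>, negligible
  against the sum of the b-series, which tends to infinity; the tail contributes at most e/2 times
  that sum.\<close>

lemma abelian_ratio:
  fixes a :: "nat \<Rightarrow> complex" and b :: "nat \<Rightarrow> real"
  assumes b: "\<And>n. b n > 0" and L: "(\<lambda>n. a n / of_real (b n)) \<longlonglongrightarrow> L"
    and sb: "\<And>w. 0 < w \<Longrightarrow> w < 1 \<Longrightarrow> summable (\<lambda>n. b n * w ^ n)"
    and top: "filterlim (\<lambda>w. \<Sum>n. b n * w ^ n) at_top (at_left 1)"
  shows "((\<lambda>w. (\<Sum>n. a n * of_real w ^ n) / of_real (\<Sum>n. b n * w ^ n)) \<longlongrightarrow> L) (at_left 1)"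
proof (rule tendstoI)
  fix e :: real assume e: "e > 0"
  define B where "B w = (\<Sum>n. b n * w ^ n)" for w
  define d where "d n = norm (a n - L * of_real (b n))" for n
  from tendstoD[OF L half_gt_zero[OF e]] obtain N where N: "\<And>n. n \<ge> N \<Longrightarrow> norm (a n / of_real (b n) - L) < e / 2"
    by (auto simp: eventually_sequentially dist_norm)
  have dN: "d n \<le> e / 2 * b n" if "n \<ge> N" for n
  proof -
    have "d n = norm (a n / of_real (b n) - L) * b n"
    proof -
      have "a n - L * of_real (b n) = (a n / of_real (b n) - L) * of_real (b n)"
        using b[of n] by (simp add: field_simps)
      then show ?thesis using b[of n] unfolding d_def by (simp only: norm_mult norm_of_real abs_of_pos)
    qed
    then show ?thesis using N[OF that] b[of n] by (simp add: mult_right_mono)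
  qed
  define C where "C = (\<Sum>n<N. d n)"
  have C: "C \<ge> 0" unfolding C_def d_def by (intro sum_nonneg) auto
  have bound: "norm ((\<Sum>n. a n * of_real w ^ n) / of_real (B w) - L) \<le> C / B w + e / 2" and Bpos: "B w > 0"
    if w: "0 < w" "w < 1" for w
  proof -
    show Bpos: "B w > 0" unfolding B_def using w b by (intro suminf_pos sb) auto
    let ?d = "\<lambda>n. d n * w ^ n" and ?f = "\<lambda>n. (if n < N then d n else 0) + e / 2 * (b n * w ^ n)"
    have le: "?d n \<le> ?f n" for n
    proof (cases "n < N")
      case True
      have "d n * w ^ n \<le> d n * 1" using w unfolding d_def by (intro mult_left_mono power_le_one) auto
      moreover have "0 \<le> e / 2 * (b n * w ^ n)" using e w b[of n] by simp
      ultimately show ?thesis using True by simp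
    next
      case False
      have "d n * w ^ n \<le> (e / 2 * b n) * w ^ n" using dN[of n] False w by (intro mult_right_mono) auto
      then show ?thesis using False by (simp add: mult.assoc)
    qed
    have sf1: "(\<lambda>n. if n < N then d n else 0) sums C"
      unfolding C_def using sums_If_finite_set[of "{..<N}" d] by simp
    have sf: "?f sums (C + e / 2 * B w)"
      unfolding B_def by (intro sums_add sf1 sums_mult summable_sums sb w)
    have sd: "summable ?d"
      by (rule summable_comparison_test'[OF sums_summable[OF sf], of 0]) (use le w in \<open>auto simp: d_def norm_mult\<close>)
    have nd: "norm ((a n - L * of_real (b n)) * of_real w ^ n) = ?d n" for n
      using w by (simp add: d_def norm_mult norm_power)
    have sn: "summable (\<lambda>n. norm ((a n - L * of_real (b n)) * of_real w ^ n))"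
      unfolding nd by (rule sd)
    have sLb: "(\<lambda>n. L * of_real (b n * w ^ n)) sums (L * of_real (B w))"
      unfolding B_def by (intro sums_mult sums_of_real summable_sums sb w)
    have "(\<lambda>n. (a n - L * of_real (b n)) * of_real w ^ n + L * of_real (b n * w ^ n)) sums
      ((\<Sum>n. (a n - L * of_real (b n)) * of_real w ^ n) + L * of_real (B w))"
      by (intro sums_add sLb summable_sums summable_norm_cancel[OF sn])
    then have "(\<Sum>n. a n * of_real w ^ n) = (\<Sum>n. (a n - L * of_real (b n)) * of_real w ^ n) + L * of_real (B w)"
      by (auto simp: algebra_simps dest: sums_unique)
    then have "(\<Sum>n. a n * of_real w ^ n) / of_real (B w) - L = (\<Sum>n. (a n - L * of_real (b n)) * of_real w ^ n) / of_real (B w)"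
      using Bpos by (simp add: field_simps)
    also have "norm \<dots> = norm (\<Sum>n. (a n - L * of_real (b n)) * of_real w ^ n) / B w"
      using Bpos by (simp add: norm_divide)
    also have "norm (\<Sum>n. (a n - L * of_real (b n)) * of_real w ^ n) \<le> (\<Sum>n. ?d n)"
      using summable_norm[OF sn] unfolding nd .
    also have "\<dots> \<le> C + e / 2 * B w"
      using suminf_le[OF le sd sums_summable[OF sf]] sums_unique[OF sf] by simp
    also have "(C + e / 2 * B w) / B w = C / B w + e / 2" using Bpos by (simp add: field_simps)
    finally show "norm ((\<Sum>n. a n * of_real w ^ n) / of_real (B w) - L) \<le> C / B w + e / 2"
      using Bpos by (simp add: divide_right_mono)
  qed
  have "((\<lambda>w. C / B w) \<longlongrightarrow> 0) (at_left 1)"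
    using top unfolding B_def by (rule tendsto_divide_0[OF tendsto_const filterlim_at_top_imp_at_infinity])
  then have "\<forall>\<^sub>F w in at_left 1. C / B w < e / 2"
    by (rule order_tendstoD(2)) (use e in simp)
  moreover have "\<forall>\<^sub>F w in at_left 1. w \<in> {0<..<(1::real)}"
    by (rule eventually_at_leftI[of 0]) auto
  ultimately show "\<forall>\<^sub>F w in at_left 1. dist ((\<Sum>n. a n * of_real w ^ n) / of_real (\<Sum>n. b n * w ^ n)) L < e"
  proof eventually_elim
    case (elim w)
    then have "norm ((\<Sum>n. a n * of_real w ^ n) / of_real (B w) - L) \<le> C / B w + e / 2"
      using bound by simp
    also have "\<dots> < e / 2 + e / 2" using elim(1) by (rule add_strict_right_mono)
    finally show ?case unfolding B_def[symmetric] dist_norm by simp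
  qed
qed

lemma plus_1_notin_nonpos_Ints: "c \<notin> \<int>\<^sub>\<le>\<^sub>0 \<Longrightarrow> c + 1 \<notin> \<int>\<^sub>\<le>\<^sub>0" for c :: complex
  using plus_one_in_nonpos_Ints_imp by blast

lemma hypF_asymp:
  assumes c: "c \<notin> \<int>\<^sub>\<le>\<^sub>0" "a + b - c = 1/2"
  shows "((\<lambda>w. of_real (sqrt (1 - w)) * hypF a b c (of_real w)) \<longlongrightarrow>
      Gamma c * of_real (sqrt pi) * rGamma a * rGamma b) (at_left 1)"
proof -
  \<comment> \<open>The coefficients are compared with those of \<open>(1 - w)\<^bsup>-1/2\<^esup>\<close>.\<close>
  define h where "h n = fps_nth (fps_hypergeo [a, b] [c] 1) n" for n
  define q :: "nat \<Rightarrow> real" where "q n = pochhammer (1/2) n / fact n" for n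
  have q: "q n > 0" for n unfolding q_def by (intro divide_pos_pos pochhammer_pos) auto
  \<comment> \<open>Binomial series of (1 - w)^(-1/2): positive coefficients and a sum tending to
    infinity at 1, as \<open>abelian_ratio\<close> requires.\<close>
  have qs: "(\<lambda>n. q n * w ^ n) sums (1 / sqrt (1 - w))" if "0 < w" "w < 1" for w
  proof -
    have "(\<lambda>n. (-1/2 gchoose n) * (- w) ^ n) sums (1 + - w) powr (-1/2)"
      using that by (intro gen_binomial_real) auto
    moreover have "(-1/2 gchoose n) * (- w) ^ n = q n * w ^ n" for n
    proof -
      have "(-1/2 gchoose n) * (- w) ^ n = ((- 1) ^ n * (- 1) ^ n) * (pochhammer (1/2) n / fact n * w ^ n)"
        unfolding gbinomial_pochhammer power_minus[of w] by simp
      also have "(- 1) ^ n * (- 1) ^ n = (1::real)" by (simp flip: power_mult_distrib)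
      finally show ?thesis by (simp add: q_def)
    qed
    moreover have "(1 + - w) powr (-1/2) = 1 / sqrt (1 - w)"
      using that by (simp add: powr_minus powr_half_sqrt divide_simps)
    ultimately show ?thesis by simp
  qed
  have r: "rGamma c \<noteq> 0" "rGamma (1/2 :: complex) \<noteq> 0" "rGamma (1/2 :: complex) = 1 / of_real (sqrt pi)"
    apply (simp add: rGamma_eq_zero_iff c(1))
    by (simp_all add: rGamma_inverse_Gamma Gamma_one_half_complex divide_simps)
  have lim: "(\<lambda>n. rGamma_series a n * rGamma_series b n / (rGamma_series c n * rGamma_series (1/2) n))
      \<longlonglongrightarrow> rGamma a * rGamma b / (rGamma c * rGamma (1/2))"
    using r by (intro tendsto_intros) auto
  \<comment> \<open>\<open>rGamma_series z n\<close> contains \<open>pochhammer z (n + 1)\<close>,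
    whence the index \<open>Suc n\<close>. The factorials cancel, and so do the powers of n since a
    + b = c + 1/2.\<close>
  have eq: "rGamma_series a n * rGamma_series b n / (rGamma_series c n * rGamma_series (1/2) n) = h (Suc n) / of_real (q (Suc n))" for n
  proof -
    define l :: complex where "l = of_real (ln (of_nat n))"
    have "exp (a * l) * exp (b * l) = exp (c * l) * exp (1/2 * l)"
    proof -
      have "a * l + b * l = c * l + 1/2 * l" using c(2) by (metis distrib_right add.commute diff_eq_eq)
      then show ?thesis by (simp only: exp_add[symmetric])
    qed
    moreover have "pochhammer c (Suc n) \<noteq> 0" "pochhammer (1/2 :: complex) (Suc n) \<noteq> 0"
      using pochhammer_nonzero(1)[OF c(1), of "Suc n"] pochhammer_pos[of "1/2 :: real" "Suc n"]
        pochhammer_of_real[of "1/2" "Suc n", where 'a = complex] by auto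
    ultimately show ?thesis
      unfolding h_def q_def rGamma_series_def l_def[symmetric] Suc_eq_plus1[symmetric]
      by (simp add: pochhammer_of_real[symmetric] divide_simps del: pochhammer_Suc fact_Suc)
  qed
  have "(\<lambda>n. h n / of_real (q n)) \<longlonglongrightarrow> Gamma c * of_real (sqrt pi) * rGamma a * rGamma b"
    using lim unfolding eq r(3) by (subst (asm) filterlim_sequentially_Suc) (simp add: rGamma_inverse_Gamma field_simps)
  moreover have "filterlim (\<lambda>w. \<Sum>n. q n * w ^ n) at_top (at_left 1)"
  proof -
    have "filterlim (\<lambda>w. 1 / sqrt (1 - w)) at_top (at_left 1)"
    proof (subst divide_inverse, simp, rule filterlim_inverse_at_top)
      show "((\<lambda>w. sqrt (1 - w)) \<longlongrightarrow> 0) (at_left 1)" by (auto intro!: tendsto_eq_intros)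
      show "\<forall>\<^sub>F w in at_left 1. 0 < sqrt (1 - w)" by (rule eventually_at_leftI[of 0]) auto
    qed
    moreover have "\<forall>\<^sub>F w in at_left 1. 1 / sqrt (1 - w) = (\<Sum>n. q n * w ^ n)"
      by (rule eventually_at_leftI[of 0]) (auto dest: qs simp: sums_iff)
    ultimately show ?thesis by (rule filterlim_cong[OF refl refl, THEN iffD1, rotated])
  qed
  ultimately have "((\<lambda>w. (\<Sum>n. h n * of_real w ^ n) / of_real (\<Sum>n. q n * w ^ n)) \<longlongrightarrow> Gamma c * of_real (sqrt pi) * rGamma a * rGamma b) (at_left 1)"
    using q qs by (intro abelian_ratio) (auto simp: sums_iff)
  moreover have "\<forall>\<^sub>F w in at_left 1. (\<Sum>n. h n * of_real w ^ n) / of_real (\<Sum>n. q n * w ^ n) = of_real (sqrt (1 - w)) * hypF a b c (of_real w)"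
    by (rule eventually_at_leftI[of 0]) (use qs in \<open>auto simp: sums_iff eval_fps_def h_def simp del: fps_hypergeo_nth\<close>)
  ultimately show ?thesis by (rule Lim_transform_eventually)
qed

text \<open>Gauss's value at 1. Euler's transformation splits off sqrt(1 - w), and the remaining
  series falls under \<open>hypF_asymp\<close> because (c - a) + (c - b) - c = 1/2.\<close>

lemma hypF_at_1:
  assumes c: "c \<notin> \<int>\<^sub>\<le>\<^sub>0" "c = a + b + 1/2"
  shows "((\<lambda>w. hypF a b c (of_real w)) \<longlongrightarrow> Gamma c * of_real (sqrt pi) * rGamma (c - a) * rGamma (c - b)) (at_left 1)"
proof -
  have "((\<lambda>w. of_real (sqrt (1 - w)) * hypF (c - a) (c - b) c (of_real w)) \<longlongrightarrow>
      Gamma c * of_real (sqrt pi) * rGamma (c - a) * rGamma (c - b)) (at_left 1)"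
    by (rule hypF_asymp[OF c(1)]) (simp add: c(2))
  moreover have "\<forall>\<^sub>F w in at_left 1. of_real (sqrt (1 - w)) * hypF (c - a) (c - b) c (of_real w) = hypF a b c (of_real w)"
  proof (rule eventually_at_leftI[of 0])
    fix w :: real assume w: "w \<in> {0<..<1}"
    have "(1 - of_real w :: complex) powr (c - a - b) = of_real ((1 - w) powr (1/2))"
      using w c(2) powr_of_real[of "1 - w" "1/2"] by simp
    also have "(1 - w) powr (1/2) = sqrt (1 - w)" using w by (simp add: powr_half_sqrt)
    finally show "of_real (sqrt (1 - w)) * hypF (c - a) (c - b) c (of_real w) = hypF a b c (of_real w)"
      using hypF_euler[OF c(1), of "of_real w" a b] w by simp
  qed simp
  ultimately show ?thesis by (rule Lim_transform_eventually)
qed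

lemma has_field_derivative_hypF:
  assumes c: "c \<notin> \<int>\<^sub>\<le>\<^sub>0" and z: "norm z < 1"
  shows "(hypF a b c has_field_derivative a * b / c * hypF (a + 1) (b + 1) (c + 1) z) (at z)"
proof -
  have eq: "fps_deriv (fps_hypergeo [a, b] [c] 1) = fps_const (a * b / c) * fps_hypergeo [a + 1, b + 1] [c + 1] 1"
  proof (rule fps_ext)
    fix n
    have "(of_nat (Suc n) :: complex) \<noteq> 0" by (simp del: of_nat_Suc)
    moreover have "c \<noteq> 0" using c by auto
    ultimately show "fps_nth (fps_deriv (fps_hypergeo [a, b] [c] 1)) n = fps_nth (fps_const (a * b / c) * fps_hypergeo [a + 1, b + 1] [c + 1] 1) n"
      using pochhammer_nonzero(1)[OF plus_1_notin_nonpos_Ints[OF c], of n]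
      by (simp add: pochhammer_rec divide_simps del: of_nat_Suc mult_Suc)
  qed
  have r: "fps_conv_radius (fps_hypergeo [a + 1, b + 1] [c + 1] 1) \<ge> 1"
    by (rule hypF_conv_radius[OF plus_1_notin_nonpos_Ints[OF c]])
  have z': "ereal (norm z) < 1" using z by simp
  have "eval_fps (fps_deriv (fps_hypergeo [a, b] [c] 1)) z = a * b / c * hypF (a + 1) (b + 1) (c + 1) z"
    unfolding eq using less_le_trans[OF z' r] by (simp add: eval_fps_mult)
  then show ?thesis
    using has_field_derivative_eval_fps[OF less_le_trans[OF z' hypF_conv_radius[OF c]], of a b UNIV] by simp
qed

text \<open>Differentiation raises all parameters by 1, and (a + 1) + (b + 1) - (c + 1) = 1/2 is the
  case of \<open>hypF_asymp\<close>. The functional equation absorbs a b / c; in terms of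
  \<open>rGamma\<close> it holds for all a and b.\<close>

lemma hypF_deriv_asymp:
  assumes c: "c \<notin> \<int>\<^sub>\<le>\<^sub>0" "c = a + b + 1/2"
  shows "((\<lambda>w. of_real (sqrt (1 - w)) * (a * b / c * hypF (a + 1) (b + 1) (c + 1) (of_real w))) \<longlongrightarrow>
     Gamma c * of_real (sqrt pi) * rGamma a * rGamma b) (at_left 1)"
proof -
  have "((\<lambda>w. of_real (sqrt (1 - w)) * hypF (a + 1) (b + 1) (c + 1) (of_real w)) \<longlongrightarrow>
     Gamma (c + 1) * of_real (sqrt pi) * rGamma (a + 1) * rGamma (b + 1)) (at_left 1)"
    by (rule hypF_asymp[OF plus_1_notin_nonpos_Ints[OF c(1)]]) (simp add: c(2))
  then have "((\<lambda>w. a * b / c * (of_real (sqrt (1 - w)) * hypF (a + 1) (b + 1) (c + 1) (of_real w))) \<longlongrightarrow>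
     a * b / c * (Gamma (c + 1) * of_real (sqrt pi) * rGamma (a + 1) * rGamma (b + 1))) (at_left 1)"
    by (rule tendsto_mult_left)
  moreover have "a * b / c * (Gamma (c + 1) * of_real (sqrt pi) * rGamma (a + 1) * rGamma (b + 1)) = Gamma c * of_real (sqrt pi) * rGamma a * rGamma b"
  proof -
    have "c \<noteq> 0" using c(1) by auto
    then show ?thesis using Gamma_plus1[of c] c(1) by (simp flip: rGamma_plus1[of a] rGamma_plus1[of b])
  qed
  ultimately show ?thesis by (simp add: mult_ac)
qed

section \<open>Solutions of the Legendre equation\<close>

definition leg_sol :: "complex \<Rightarrow> complex \<Rightarrow> complex set \<Rightarrow> (complex \<Rightarrow> complex) \<Rightarrow> bool"
  where "leg_sol a b D v \<longleftrightarrow> (\<exists>v1 v2. \<forall>x\<in>D.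
    (v has_field_derivative v1 x) (at x) \<and> (v1 has_field_derivative v2 x) (at x) \<and>
    (1 - x\<^sup>2) * v2 x - (2 * a + 2 * b + 1) * x * v1 x = 4 * a * b * v x)"

lemma leg_solE:
  assumes "leg_sol a b D v"
  obtains v1 v2 where "\<And>x. x \<in> D \<Longrightarrow> (v has_field_derivative v1 x) (at x)"
    and "\<And>x. x \<in> D \<Longrightarrow> (v1 has_field_derivative v2 x) (at x)"
    and "\<And>x. x \<in> D \<Longrightarrow> (1 - x\<^sup>2) * v2 x - (2 * a + 2 * b + 1) * x * v1 x = 4 * a * b * v x"
  using assms unfolding leg_sol_def by blast

lemma leg_solI:
  assumes "\<And>x. x \<in> D \<Longrightarrow> (v has_field_derivative v1 x) (at x)"
    and "\<And>x. x \<in> D \<Longrightarrow> (v1 has_field_derivative v2 x) (at x)"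
    and "\<And>x. x \<in> D \<Longrightarrow> (1 - x\<^sup>2) * v2 x - (2 * a + 2 * b + 1) * x * v1 x = 4 * a * b * v x"
  shows "leg_sol a b D v"
  using assms unfolding leg_sol_def by blast

lemma leg_sol_cong:
  assumes "leg_sol a b D f" "open D" "\<And>z. z \<in> D \<Longrightarrow> f z = g z"
  shows "leg_sol a b D g"
proof -
  obtain f1 f2 where d: "\<And>x. x \<in> D \<Longrightarrow> (f has_field_derivative f1 x) (at x)"
    "\<And>x. x \<in> D \<Longrightarrow> (f1 has_field_derivative f2 x) (at x)"
    "\<And>x. x \<in> D \<Longrightarrow> (1 - x\<^sup>2) * f2 x - (2 * a + 2 * b + 1) * x * f1 x = 4 * a * b * f x"
    using leg_solE[OF assms(1)] by metis
  show ?thesis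
  proof (rule leg_solI)
    fix z assume z: "z \<in> D"
    show "(g has_field_derivative f1 z) (at z)"
      by (rule has_field_derivative_transform_within_open[OF d(1)[OF z] assms(2) z]) (simp add: assms(3))
  qed (use d assms(3) in auto)
qed

lemma leg_sol_even:
  assumes f: "hyp_sol a b (1/2) D f" and D: "\<And>x. x \<in> E \<Longrightarrow> x\<^sup>2 \<in> D"
  shows "leg_sol a b E (\<lambda>x. f (x\<^sup>2))"
proof -
  obtain f1 f2 where d: "\<And>z. z \<in> D \<Longrightarrow> (f has_field_derivative f1 z) (at z)"
    "\<And>z. z \<in> D \<Longrightarrow> (f1 has_field_derivative f2 z) (at z)"
    "\<And>z. z \<in> D \<Longrightarrow> z * (1 - z) * f2 z + (1/2 - (a + b + 1) * z) * f1 z = a * b * f z"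
    using hyp_solE[OF f] by metis
  show ?thesis
  proof (rule leg_solI)
    fix x assume x: "x \<in> E"
    have sq: "((\<lambda>x. x\<^sup>2) has_field_derivative 2 * x) (at x)"
      by (auto intro!: derivative_eq_intros)
    note df = DERIV_chain2[OF d(1)[OF D[OF x]] sq] and df1 = DERIV_chain2[OF d(2)[OF D[OF x]] sq]
    show "((\<lambda>x. f (x\<^sup>2)) has_field_derivative f1 (x\<^sup>2) * (2 * x)) (at x)" by (rule df)
    show "((\<lambda>x. f1 (x\<^sup>2) * (2 * x)) has_field_derivative f2 (x\<^sup>2) * (4 * x\<^sup>2) + 2 * f1 (x\<^sup>2)) (at x)"
      by (rule DERIV_cong, rule DERIV_mult[OF df1 DERIV_cmult[OF DERIV_ident]]) (simp add: power2_eq_square)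
    show "(1 - x\<^sup>2) * (f2 (x\<^sup>2) * (4 * x\<^sup>2) + 2 * f1 (x\<^sup>2)) - (2 * a + 2 * b + 1) * x * (f1 (x\<^sup>2) * (2 * x)) = 4 * a * b * f (x\<^sup>2)"
    proof -
      define y where "y = x\<^sup>2"
      have "(1 - x\<^sup>2) * (f2 (x\<^sup>2) * (4 * x\<^sup>2) + 2 * f1 (x\<^sup>2)) - (2 * a + 2 * b + 1) * x * (f1 (x\<^sup>2) * (2 * x))
        = 4 * (y * (1 - y) * f2 y + (1/2 - (a + b + 1) * y) * f1 y)"
        unfolding y_def by (simp add: field_simps power2_eq_square)
      then show ?thesis using d(3)[OF D[OF x]] by (simp add: y_def)
    qed
  qed
qed

text \<open>The equation (a, b; 1/2) has the exponents 0 and 1/2 at y = 0. The second one, y^(1/2) =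
  x, gives the odd solutions.\<close>

lemma leg_sol_odd:
  assumes f: "hyp_sol (a + 1/2) (b + 1/2) (3/2) D f" and D: "\<And>x. x \<in> E \<Longrightarrow> x\<^sup>2 \<in> D"
  shows "leg_sol a b E (\<lambda>x. x * f (x\<^sup>2))"
proof -
  obtain f1 f2 where d: "\<And>z. z \<in> D \<Longrightarrow> (f has_field_derivative f1 z) (at z)"
    "\<And>z. z \<in> D \<Longrightarrow> (f1 has_field_derivative f2 z) (at z)"
    "\<And>z. z \<in> D \<Longrightarrow> z * (1 - z) * f2 z + (3/2 - ((a + 1/2) + (b + 1/2) + 1) * z) * f1 z = (a + 1/2) * (b + 1/2) * f z"
    using hyp_solE[OF f] by metis
  show ?thesis
  proof (rule leg_solI)
    fix x assume x: "x \<in> E"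
    have sq: "((\<lambda>x. x\<^sup>2) has_field_derivative 2 * x) (at x)"
      by (auto intro!: derivative_eq_intros)
    note df = DERIV_chain2[OF d(1)[OF D[OF x]] sq] and df1 = DERIV_chain2[OF d(2)[OF D[OF x]] sq]
    show "((\<lambda>x. x * f (x\<^sup>2)) has_field_derivative f (x\<^sup>2) + 2 * x\<^sup>2 * f1 (x\<^sup>2)) (at x)"
      by (rule DERIV_cong, rule DERIV_mult[OF DERIV_ident df]) (simp add: power2_eq_square)
    show "((\<lambda>x. f (x\<^sup>2) + 2 * x\<^sup>2 * f1 (x\<^sup>2)) has_field_derivative 6 * x * f1 (x\<^sup>2) + 4 * x^3 * f2 (x\<^sup>2)) (at x)"
      by (rule DERIV_cong, rule DERIV_add[OF df DERIV_mult[OF DERIV_cmult[OF sq] df1]])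
        (simp add: power2_eq_square power3_eq_cube)
    show "(1 - x\<^sup>2) * (6 * x * f1 (x\<^sup>2) + 4 * x^3 * f2 (x\<^sup>2)) - (2 * a + 2 * b + 1) * x * (f (x\<^sup>2) + 2 * x\<^sup>2 * f1 (x\<^sup>2)) = 4 * a * b * (x * f (x\<^sup>2))"
    proof -
      define y where "y = x\<^sup>2"
      have "(1 - x\<^sup>2) * (6 * x * f1 (x\<^sup>2) + 4 * x^3 * f2 (x\<^sup>2)) - (2 * a + 2 * b + 1) * x * (f (x\<^sup>2) + 2 * x\<^sup>2 * f1 (x\<^sup>2)) - 4 * a * b * (x * f (x\<^sup>2))
        = 4 * x * ((y * (1 - y) * f2 y + (3/2 - ((a + 1/2) + (b + 1/2) + 1) * y) * f1 y) - (a + 1/2) * (b + 1/2) * f y)"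
        unfolding y_def by (simp add: field_simps power2_eq_square power3_eq_cube)
      then show ?thesis using d(3)[OF D[OF x]] by (simp add: y_def)
    qed
  qed
qed

text \<open>Abel's identity: the Wronskian w satisfies (1 - x^2) w' = (2 a + 2 b + 1) x w, so the
  weighted product has derivative 0 on the convex set D. The weight is a holomorphic principal power
  because 1 - x^2 avoids the cut.\<close>

lemma leg_wronskian:
  fixes a b :: complex and u v :: "complex \<Rightarrow> complex"
  assumes D: "convex D" "\<And>x. x \<in> D \<Longrightarrow> 1 - x\<^sup>2 \<notin> \<real>\<^sub>\<le>\<^sub>0"
    and u: "\<And>x. x \<in> D \<Longrightarrow> (u has_field_derivative u1 x) (at x)"
      "\<And>x. x \<in> D \<Longrightarrow> (u1 has_field_derivative u2 x) (at x)"
      "\<And>x. x \<in> D \<Longrightarrow> (1 - x\<^sup>2) * u2 x - (2 * a + 2 * b + 1) * x * u1 x = 4 * a * b * u x"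
    and v: "\<And>x. x \<in> D \<Longrightarrow> (v has_field_derivative v1 x) (at x)"
      "\<And>x. x \<in> D \<Longrightarrow> (v1 has_field_derivative v2 x) (at x)"
      "\<And>x. x \<in> D \<Longrightarrow> (1 - x\<^sup>2) * v2 x - (2 * a + 2 * b + 1) * x * v1 x = 4 * a * b * v x"
  shows "\<exists>K. \<forall>x\<in>D. (1 - x\<^sup>2) powr (a + b + 1/2) * (u x * v1 x - u1 x * v x) = K"
proof (rule has_field_derivative_zero_constant[OF D(1)])
  fix x assume x: "x \<in> D"
  let ?P = "\<lambda>x. (1 - x\<^sup>2) powr (a + b + 1/2)"
  have nz: "1 - x\<^sup>2 \<noteq> 0" using D(2)[OF x] by auto
  have dP: "(?P has_field_derivative ?P x * (- (2 * a + 2 * b + 1) * x / (1 - x\<^sup>2))) (at x)"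
  proof (rule DERIV_cong)
    have "((\<lambda>x. 1 - x\<^sup>2) has_field_derivative - (2 * x)) (at x)"
      by (auto intro!: derivative_eq_intros)
    then show "(?P has_field_derivative (a + b + 1/2) * (1 - x\<^sup>2) powr (a + b + 1/2 - 1) * - (2 * x)) (at x)"
      by (rule DERIV_chain2[where g = "\<lambda>x. 1 - x\<^sup>2", OF has_field_derivative_powr[OF D(2)[OF x]]])
    show "(a + b + 1/2) * (1 - x\<^sup>2) powr (a + b + 1/2 - 1) * - (2 * x) = ?P x * (- (2 * a + 2 * b + 1) * x / (1 - x\<^sup>2))"
      unfolding powr_diff using nz by (simp add: algebra_simps)
  qed
  have dW: "((\<lambda>x. u x * v1 x - u1 x * v x) has_field_derivative u x * v2 x - u2 x * v x) (at x)"
    by (rule DERIV_cong, rule DERIV_diff[OF DERIV_mult[OF u(1)[OF x] v(2)[OF x]] DERIV_mult[OF u(2)[OF x] v(1)[OF x]]])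
      (simp add: algebra_simps)
  have "(1 - x\<^sup>2) * (u x * v2 x - u2 x * v x) = (2 * a + 2 * b + 1) * x * (u x * v1 x - u1 x * v x)"
    using u(3)[OF x] v(3)[OF x] by algebra
  then have "u x * v2 x - u2 x * v x = t * (u x * v1 x - u1 x * v x)" if "t = (2 * a + 2 * b + 1) * x / (1 - x\<^sup>2)" for t
    unfolding that using nz by (simp add: divide_simps) (simp only: mult_ac)
  then have "?P x * - t * (u x * v1 x - u1 x * v x) + (u x * v2 x - u2 x * v x) * ?P x = 0"
    if "t = (2 * a + 2 * b + 1) * x / (1 - x\<^sup>2)" for t
    using that by simp
  then have "?P x * (- (2 * a + 2 * b + 1) * x / (1 - x\<^sup>2)) * (u x * v1 x - u1 x * v x) + (u x * v2 x - u2 x * v x) * ?P x = 0"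
    by (simp only: mult_minus_left minus_divide_left)
  then show "((\<lambda>x. ?P x * (u x * v1 x - u1 x * v x)) has_field_derivative 0) (at x within D)"
    using DERIV_cong[OF DERIV_mult[OF dP dW]] has_field_derivative_at_within by blast
qed

section \<open>The even and odd solutions on the unit disc\<close>

definition even_sol :: "complex \<Rightarrow> complex \<Rightarrow> complex \<Rightarrow> complex"
  where "even_sol a b x = hypF a b (1/2) (x\<^sup>2)"

definition odd_sol :: "complex \<Rightarrow> complex \<Rightarrow> complex \<Rightarrow> complex"
  where "odd_sol a b x = x * hypF (a + 1/2) (b + 1/2) (3/2) (x\<^sup>2)"

lemma halves_notin_nonpos_Ints: "(1/2 :: complex) \<notin> \<int>\<^sub>\<le>\<^sub>0" "(3/2 :: complex) \<notin> \<int>\<^sub>\<le>\<^sub>0"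
proof -
  have *: "of_real r \<notin> (\<int>\<^sub>\<le>\<^sub>0 :: complex set)" if "r > 0" for r :: real
  proof
    assume "of_real r \<in> (\<int>\<^sub>\<le>\<^sub>0 :: complex set)"
    then obtain n where n: "complex_of_real r = of_int n" "n \<le> 0" by (rule nonpos_Ints_cases)
    have "r = Re (of_int n)" using arg_cong[OF n(1), of Re] by simp
    then show False using n(2) that by simp
  qed
  show "(1/2 :: complex) \<notin> \<int>\<^sub>\<le>\<^sub>0" "(3/2 :: complex) \<notin> \<int>\<^sub>\<le>\<^sub>0"
    using *[of "1/2"] *[of "3/2"] by simp_all
qed

lemma norm_power2_less_1: "norm x < 1 \<Longrightarrow> norm (x\<^sup>2) < 1" for x :: complex
  by (simp add: norm_power power_less_one_iff)

lemma leg_sol_even_sol: "leg_sol a b (ball 0 1) (even_sol a b)"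
  unfolding even_sol_def [abs_def]
  by (rule leg_sol_even[OF hyp_sol_hypF[OF halves_notin_nonpos_Ints(1)]]) (use norm_power2_less_1 in auto)

lemma leg_sol_odd_sol: "leg_sol a b (ball 0 1) (odd_sol a b)"
  unfolding odd_sol_def [abs_def]
  by (rule leg_sol_odd[OF hyp_sol_hypF[OF halves_notin_nonpos_Ints(2)]]) (use norm_power2_less_1 in auto)

lemma even_odd_sol_minus: "even_sol a b (- x) = even_sol a b x" "odd_sol a b (- x) = - odd_sol a b x"
  by (simp_all add: even_sol_def odd_sol_def)

lemma even_odd_sol_commute: "even_sol a b = even_sol b a" "odd_sol a b = odd_sol b a"
  by (simp_all add: even_sol_def [abs_def] odd_sol_def [abs_def] hypF_commute)

section \<open>The solutions at infinity\<close>

lemma square_real_imp_real: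
  assumes "x\<^sup>2 = of_real r" "r \<ge> 0" shows "Im x = 0"
proof -
  have "x\<^sup>2 = (of_real (sqrt r))\<^sup>2" using assms by (simp flip: of_real_power)
  then show ?thesis by (auto simp: power2_eq_iff)
qed

lemma one_minus_square_notin_nonpos_Reals:
  assumes "Im x \<noteq> 0 \<or> norm x < 1" shows "1 - x\<^sup>2 \<notin> \<real>\<^sub>\<le>\<^sub>0"
proof
  assume "1 - x\<^sup>2 \<in> \<real>\<^sub>\<le>\<^sub>0"
  then obtain r where r: "1 - x\<^sup>2 = of_real r" "r \<le> 0" by (auto elim: nonpos_Reals_cases)
  then have e: "x\<^sup>2 = of_real (1 - r)" by (simp add: algebra_simps)
  with r have "Im x = 0" by (intro square_real_imp_real[OF e]) auto
  moreover have "norm (x\<^sup>2) \<ge> 1" unfolding e norm_of_real using r by auto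
  ultimately show False using assms norm_power2_less_1[of x] by auto
qed

lemma inverse_one_minus_square_slit:
  assumes "Im x \<noteq> 0" shows "1 / (1 - x\<^sup>2) \<in> slit_plane"
proof (rule ccontr)
  assume "1 / (1 - x\<^sup>2) \<notin> slit_plane"
  then obtain t where t: "1 / (1 - x\<^sup>2) = of_real t" "t \<ge> 1" by (auto simp: slit_plane_def)
  then have "1 - x\<^sup>2 = of_real (1 / t)"
    by (cases "1 - x\<^sup>2 = 0") (auto simp: field_simps)
  then have "x\<^sup>2 = of_real (1 - 1 / t)" by (simp add: algebra_simps)
  with t have "Im x = 0" by (intro square_real_imp_real[of x "1 - 1 / t"]) auto
  then show False using assms by simp
qed

text \<open>\<open>leg_inf a b\<close> is the V of the introduction and \<open>leg_inf b a\<close>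
  is W. Since b + (1/2 - a) + 1/2 = b - a + 1, the hypergeometric factor is covered by
  \<open>hyp2F1_sol\<close>.\<close>

definition leg_inf :: "complex \<Rightarrow> complex \<Rightarrow> complex \<Rightarrow> complex"
  where "leg_inf a b x = (1 - x\<^sup>2) powr (- b) * hyp2F1 b (1/2 - a) (b - a + 1) (1 / (1 - x\<^sup>2))"

lemma leg_inf_minus: "leg_inf a b (- x) = leg_inf a b x"
  by (simp add: leg_inf_def)

text \<open>With y = x^2 the argument is 1/(1 - y) = 1 - y/(y - 1). So V arises by the reflection z
  -> 1 - z, which turns the third parameter into 1/2, followed by Pfaff's transformation.\<close>

lemma leg_sol_leg_inf:
  assumes c: "b - a + 1 \<notin> \<int>\<^sub>\<le>\<^sub>0"
  shows "leg_sol a b {x. Im x \<noteq> 0} (leg_inf a b)"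
proof -
  let ?F = "hyp2F1 b (1/2 - a) (b - a + 1)"
  have "hyp_sol b (1/2 - a) (b + (1/2 - a) - (b - a + 1) + 1) {w. 1 - w \<in> slit_plane} (\<lambda>w. ?F (1 - w))"
    by (rule hyp_sol_reflect[OF hyp2F1_sol(1)[OF c]]) auto
  then have *: "hyp_sol b (1/2 - a) (1/2) {w. 1 - w \<in> slit_plane} (\<lambda>w. ?F (1 - w))"
    by simp
  let ?E = "{y. 1 - y \<notin> \<real>\<^sub>\<le>\<^sub>0 \<and> 1 / (1 - y) \<in> slit_plane}"
  have w: "1 - y / (y - 1) = 1 / (1 - y)" if "1 - y \<notin> \<real>\<^sub>\<le>\<^sub>0" for y :: complex
  proof -
    have "1 - y \<noteq> 0" "y - 1 \<noteq> 0" using that by auto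
    then show ?thesis by (simp add: divide_simps)
  qed
  have "hyp_sol b a (1/2) ?E (\<lambda>y. (1 - y) powr (- b) * ?F (1 - y / (y - 1)))"
    by (rule hyp_sol_pfaff[OF *]) (auto simp: w)
  then have "hyp_sol a b (1/2) ?E (\<lambda>y. (1 - y) powr (- b) * ?F (1 - y / (y - 1)))"
    by (simp only: hyp_sol_commute)
  then have "leg_sol a b {x. Im x \<noteq> 0} (\<lambda>x. (1 - x\<^sup>2) powr (- b) * ?F (1 - x\<^sup>2 / (x\<^sup>2 - 1)))"
    by (rule leg_sol_even) (use one_minus_square_notin_nonpos_Reals inverse_one_minus_square_slit in auto)
  then show ?thesis
  proof (rule leg_sol_cong)
    show "(1 - x\<^sup>2) powr (- b) * ?F (1 - x\<^sup>2 / (x\<^sup>2 - 1)) = leg_inf a b x" if "x \<in> {x. Im x \<noteq> 0}" for x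
    unfolding leg_inf_def using w[of "x\<^sup>2"] one_minus_square_notin_nonpos_Reals[of x] that by auto
    show "open {x. Im x \<noteq> 0}" by (intro open_Collect_neq continuous_intros)
  qed
qed

text \<open>For x = i y the hypergeometric argument is 1/(1 + y^2), which increases to 1 as y
  decreases to 0. The value comes from \<open>hypF_at_1\<close>, the derivative from
  \<open>hypF_deriv_asymp\<close>, whose singular factor is cancelled by an inner derivative of
  order y.\<close>

lemma leg_inf_limits:
  assumes c: "b - a + 1 \<notin> \<int>\<^sub>\<le>\<^sub>0"
  shows "((\<lambda>y::real. leg_inf a b (\<i> * of_real y)) \<longlongrightarrow>
      Gamma (b - a + 1) * of_real (sqrt pi) * rGamma (1 - a) * rGamma (b + 1/2)) (at_right 0)"
    and "\<exists>d. (\<forall>y>0. (leg_inf a b has_field_derivative d y) (at (\<i> * of_real y))) \<and>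
      (d \<longlongrightarrow> 2 * \<i> * (Gamma (b - a + 1) * of_real (sqrt pi) * rGamma b * rGamma (1/2 - a))) (at_right (0::real))"
proof -
  let ?c = "b - a + 1"
  define w :: "real \<Rightarrow> real" where "w y = 1 / (1 + y\<^sup>2)" for y
  have w01: "w y > 0" "w y < 1" if "y > 0" for y
    unfolding w_def using that by (auto simp: divide_less_eq_1_pos add_pos_pos)
  have w1: "filterlim w (at_left 1) (at_right 0)"
    unfolding filterlim_at
  proof
    show "\<forall>\<^sub>F y in at_right 0. w y \<in> {..<1} \<and> w y \<noteq> 1"
    proof (rule eventually_at_rightI[of 0 1])
      fix y :: real assume "y \<in> {0<..<1}"
      then show "w y \<in> {..<1} \<and> w y \<noteq> 1" using w01[of y] by simp
    qed simp
    show "(w \<longlongrightarrow> 1) (at_right 0)" unfolding w_def [abs_def] by (auto intro!: tendsto_eq_intros)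
  qed
  have sq: "1 - (\<i> * of_real y)\<^sup>2 = of_real (1 + y\<^sup>2)" "1 / (1 - (\<i> * of_real y)\<^sup>2) = of_real (w y)" for y
    by (simp_all add: power_mult_distrib w_def)
  have ex: "?c = b + (1/2 - a) + 1/2" by simp
  note F = hyp2F1_sol[OF c ex]
  have wb: "norm (complex_of_real (w y)) < 1" if "y > 0" for y
    using w01[OF that] by (simp only: norm_of_real abs_of_pos)
  define P where "P y = (of_real (1 + y\<^sup>2) :: complex) powr (- b)" for y
  have P1: "(P \<longlongrightarrow> 1) (at_right 0)"
  proof -
    have "((\<lambda>y. (of_real (1 + y\<^sup>2) :: complex) powr (- b)) \<longlongrightarrow> (of_real (1 + 0\<^sup>2)) powr (- b)) (at_right 0)"
      by (intro tendsto_intros) auto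
    then show ?thesis by (simp add: P_def [abs_def])
  qed
  have F1: "((\<lambda>y. hypF b (1/2 - a) ?c (of_real (w y))) \<longlongrightarrow>
      Gamma ?c * of_real (sqrt pi) * rGamma (1 - a) * rGamma (b + 1/2)) (at_right 0)"
    using filterlim_compose[OF hypF_at_1[OF c ex] w1] by (simp add: algebra_simps)
  have "((\<lambda>y. P y * hypF b (1/2 - a) ?c (of_real (w y))) \<longlongrightarrow>
      1 * (Gamma ?c * of_real (sqrt pi) * rGamma (1 - a) * rGamma (b + 1/2))) (at_right 0)"
    by (rule tendsto_mult[OF P1 F1])
  moreover have "\<forall>\<^sub>F y in at_right 0. P y * hypF b (1/2 - a) ?c (of_real (w y)) = leg_inf a b (\<i> * of_real y)"
  proof (rule eventually_at_rightI[of 0 1])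
    fix y :: real assume "y \<in> {0<..<1}"
    then have y: "y > 0" by simp
    show "P y * hypF b (1/2 - a) ?c (of_real (w y)) = leg_inf a b (\<i> * of_real y)"
      unfolding leg_inf_def sq(2) unfolding sq(1) P_def F(2)[OF wb[OF y]] ..
  qed simp
  ultimately show "((\<lambda>y::real. leg_inf a b (\<i> * of_real y)) \<longlongrightarrow>
      Gamma ?c * of_real (sqrt pi) * rGamma (1 - a) * rGamma (b + 1/2)) (at_right 0)"
    unfolding mult_1 by (rule Lim_transform_eventually)
  define F' where "F' z = b * (1/2 - a) / ?c * hypF (b + 1) (1/2 - a + 1) (?c + 1) z" for z
  \<comment> \<open>The first summand comes from differentiating the power and vanishes with y in
    the limit; the second comes from the hypergeometric factor and carries the whole limit.\<close>
  define d where "d y = P y * (b / of_real (1 + y\<^sup>2) * (2 * \<i> * of_real y)) * hypF b (1/2 - a) ?c (of_real (w y))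
     + P y * (F' (of_real (w y)) * (2 * \<i> * of_real y / (of_real (1 + y\<^sup>2))\<^sup>2))" for y :: real
  have "(leg_inf a b has_field_derivative d y) (at (\<i> * of_real y))" if y: "y > 0" for y
  proof -
    define x where "x = \<i> * of_real y"
    have x: "Im x \<noteq> 0" "1 - x\<^sup>2 \<notin> \<real>\<^sub>\<le>\<^sub>0" using y one_minus_square_notin_nonpos_Reals[of x] by (auto simp: x_def)
    have nz: "1 - x\<^sup>2 \<noteq> 0" using x(2) by auto
    have du: "((\<lambda>x. 1 - x\<^sup>2) has_field_derivative - (2 * x)) (at x)"
      by (auto intro!: derivative_eq_intros)
    have dp: "((\<lambda>x. (1 - x\<^sup>2) powr (- b)) has_field_derivative (- b * (1 - x\<^sup>2) powr (- b - 1)) * - (2 * x)) (at x)"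
      by (rule DERIV_chain2[where g = "\<lambda>x. 1 - x\<^sup>2", OF has_field_derivative_powr[OF x(2)] du])
    have dw: "((\<lambda>x. 1 / (1 - x\<^sup>2)) has_field_derivative 2 * x / (1 - x\<^sup>2)\<^sup>2) (at x)"
      by (rule DERIV_cong, rule DERIV_divide[OF DERIV_const du nz]) (simp add: power2_eq_square)
    have "norm (1 / (1 - x\<^sup>2)) < 1" unfolding x_def sq(2) using wb[OF y] .
    then have wb': "1 / (1 - x\<^sup>2) \<in> ball 0 1" by simp
    have dF: "(hyp2F1 b (1/2 - a) ?c has_field_derivative F' (1 / (1 - x\<^sup>2))) (at (1 / (1 - x\<^sup>2)))"
    proof (rule has_field_derivative_transform_within_open[OF _ open_ball wb'])
      show "(hypF b (1/2 - a) ?c has_field_derivative F' (1 / (1 - x\<^sup>2))) (at (1 / (1 - x\<^sup>2)))"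
        unfolding F'_def by (rule has_field_derivative_hypF[OF c]) (use wb' in simp)
    qed (use F(2) in auto)
    show ?thesis unfolding x_def[symmetric]
    proof (rule DERIV_cong)
      show "(leg_inf a b has_field_derivative (- b * (1 - x\<^sup>2) powr (- b - 1)) * - (2 * x) * hyp2F1 b (1/2 - a) ?c (1 / (1 - x\<^sup>2))
         + F' (1 / (1 - x\<^sup>2)) * (2 * x / (1 - x\<^sup>2)\<^sup>2) * (1 - x\<^sup>2) powr (- b)) (at x)"
        unfolding leg_inf_def [abs_def]
        by (rule DERIV_mult[OF dp DERIV_chain2[where g = "\<lambda>x. 1 / (1 - x\<^sup>2)", OF dF dw]])
      show "(- b * (1 - x\<^sup>2) powr (- b - 1)) * - (2 * x) * hyp2F1 b (1/2 - a) ?c (1 / (1 - x\<^sup>2))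
         + F' (1 / (1 - x\<^sup>2)) * (2 * x / (1 - x\<^sup>2)\<^sup>2) * (1 - x\<^sup>2) powr (- b) = d y"
        unfolding powr_diff x_def sq(2) unfolding sq(1) d_def P_def F(2)[OF wb[OF y]] using y by (simp add: mult_ac)
    qed
  qed
  moreover have "(d \<longlongrightarrow> 2 * \<i> * (Gamma ?c * of_real (sqrt pi) * rGamma b * rGamma (1/2 - a))) (at_right 0)"
  proof -
    define S where "S y = of_real (sqrt (1 - w y)) * F' (of_real (w y))" for y
    have S: "(S \<longlongrightarrow> Gamma ?c * of_real (sqrt pi) * rGamma b * rGamma (1/2 - a)) (at_right 0)"
      using filterlim_compose[OF hypF_deriv_asymp[OF c ex] w1] unfolding S_def [abs_def] F'_def .
    have r: "((\<lambda>y. b / of_real (1 + y\<^sup>2) * (2 * \<i> * of_real y)) \<longlongrightarrow> b / of_real (1 + 0\<^sup>2) * (2 * \<i> * of_real 0)) (at_right 0)"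
      by (intro tendsto_intros) auto
    have q: "((\<lambda>y. 2 * \<i> * of_real (sqrt (1 + y\<^sup>2)) / (of_real (1 + y\<^sup>2))\<^sup>2) \<longlongrightarrow> 2 * \<i> * of_real (sqrt (1 + 0\<^sup>2)) / (of_real (1 + 0\<^sup>2))\<^sup>2) (at_right 0)"
      by (intro tendsto_intros) auto
    have "((\<lambda>y. P y * (b / of_real (1 + y\<^sup>2) * (2 * \<i> * of_real y)) * hypF b (1/2 - a) ?c (of_real (w y))
       + P y * (S y * (2 * \<i> * of_real (sqrt (1 + y\<^sup>2)) / (of_real (1 + y\<^sup>2))\<^sup>2)))
      \<longlongrightarrow> 1 * (b / of_real (1 + 0\<^sup>2) * (2 * \<i> * of_real 0)) * (Gamma ?c * of_real (sqrt pi) * rGamma (1 - a) * rGamma (b + 1/2))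
       + 1 * ((Gamma ?c * of_real (sqrt pi) * rGamma b * rGamma (1/2 - a)) * (2 * \<i> * of_real (sqrt (1 + 0\<^sup>2)) / (of_real (1 + 0\<^sup>2))\<^sup>2))) (at_right 0)"
      by (intro tendsto_add tendsto_mult[OF tendsto_mult[OF P1 r] F1] tendsto_mult[OF P1 tendsto_mult[OF S q]])
    moreover have "\<forall>\<^sub>F y in at_right 0. P y * (b / of_real (1 + y\<^sup>2) * (2 * \<i> * of_real y)) * hypF b (1/2 - a) ?c (of_real (w y))
       + P y * (S y * (2 * \<i> * of_real (sqrt (1 + y\<^sup>2)) / (of_real (1 + y\<^sup>2))\<^sup>2)) = d y"
    proof (rule eventually_at_rightI[of 0 1])
      fix y :: real assume y: "y \<in> {0<..<1}"
      have "1 - w y = y\<^sup>2 / (1 + y\<^sup>2)" unfolding w_def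
        by (simp add: divide_simps add_nonneg_eq_0_iff)
      \<comment> \<open>This factorisation of y supplies the factor sqrt(1 - w) that
        \<open>hypF_deriv_asymp\<close> asks for.\<close>
      then have "sqrt (1 - w y) * sqrt (1 + y\<^sup>2) = y"
        using y by (simp add: real_sqrt_divide add_nonneg_eq_0_iff)
      then have e: "of_real y = complex_of_real (sqrt (1 - w y)) * of_real (sqrt (1 + y\<^sup>2))"
        by (simp flip: of_real_mult)
      have *: "r * G * (2 * \<i> * q / d) = G * (2 * \<i> * Y / d)" if "Y = r * q" for r G q d Y :: complex
        using that by (simp add: mult_ac)
      have "S y * (2 * \<i> * of_real (sqrt (1 + y\<^sup>2)) / (of_real (1 + y\<^sup>2))\<^sup>2) = F' (of_real (w y)) * (2 * \<i> * of_real y / (of_real (1 + y\<^sup>2))\<^sup>2)"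
        unfolding S_def by (rule *[OF e])
      then show "P y * (b / of_real (1 + y\<^sup>2) * (2 * \<i> * of_real y)) * hypF b (1/2 - a) ?c (of_real (w y))
       + P y * (S y * (2 * \<i> * of_real (sqrt (1 + y\<^sup>2)) / (of_real (1 + y\<^sup>2))\<^sup>2)) = d y"
        by (simp only: d_def)
    qed simp
    ultimately have "(d \<longlongrightarrow> 1 * (b / of_real (1 + 0\<^sup>2) * (2 * \<i> * of_real 0)) * (Gamma ?c * of_real (sqrt pi) * rGamma (1 - a) * rGamma (b + 1/2))
       + 1 * ((Gamma ?c * of_real (sqrt pi) * rGamma b * rGamma (1/2 - a)) * (2 * \<i> * of_real (sqrt (1 + 0\<^sup>2)) / (of_real (1 + 0\<^sup>2))\<^sup>2))) (at_right 0)"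
      by (rule Lim_transform_eventually)
    then show ?thesis by (simp add: mult_ac)
  qed
  ultimately show "\<exists>d. (\<forall>y>0. (leg_inf a b has_field_derivative d y) (at (\<i> * of_real y))) \<and>
      (d \<longlongrightarrow> 2 * \<i> * (Gamma ?c * of_real (sqrt pi) * rGamma b * rGamma (1/2 - a))) (at_right (0::real))"
    by blast
qed

text \<open>\<open>conn_even\<close> and \<open>conn_odd\<close> are the constants A and B of V,
  namely the two limits found in \<open>leg_inf_limits\<close>.\<close>

definition conn_even :: "complex \<Rightarrow> complex \<Rightarrow> complex"
  where "conn_even a b = Gamma (b - a + 1) * of_real (sqrt pi) * rGamma (1 - a) * rGamma (b + 1/2)"

definition conn_odd :: "complex \<Rightarrow> complex \<Rightarrow> complex"
  where "conn_odd a b = 2 * \<i> * (Gamma (b - a + 1) * of_real (sqrt pi) * rGamma b * rGamma (1/2 - a))"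

text \<open>
  Coordinates of a solution with respect to \<open>E\<close>, \<open>O\<close> are weighted Wronskians, hence constant; this
  avoids a uniqueness theorem for the initial value problem.
\<close>
lemma leg_inf_eq_upper:
  assumes c: "b - a + 1 \<notin> \<int>\<^sub>\<le>\<^sub>0" and x: "Im x > 0" "norm x < 1"
  shows "leg_inf a b x = conn_even a b * even_sol a b x + conn_odd a b * odd_sol a b x"
proof -
  define D where "D = {x. Im x > 0} \<inter> ball 0 1"
  have D: "convex D" "open D" "D \<subseteq> ball 0 1" "D \<subseteq> {x. Im x \<noteq> 0}"
    unfolding D_def by (auto intro!: convex_Int convex_halfspace_Im_gt open_Int open_halfspace_Im_gt)
  have slit: "1 - x\<^sup>2 \<notin> \<real>\<^sub>\<le>\<^sub>0" if "x \<in> ball 0 1" for x :: complex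
    using that one_minus_square_notin_nonpos_Reals by auto
  let ?v = "leg_inf a b" and ?e = "even_sol a b" and ?o = "odd_sol a b"
  define S where "S = {x. Im x \<noteq> 0}"
  obtain v1 v2 where v: "\<And>x. x \<in> S \<Longrightarrow> (?v has_field_derivative v1 x) (at x)"
    "\<And>x. x \<in> S \<Longrightarrow> (v1 has_field_derivative v2 x) (at x)"
    "\<And>x. x \<in> S \<Longrightarrow> (1 - x\<^sup>2) * v2 x - (2 * a + 2 * b + 1) * x * v1 x = 4 * a * b * ?v x"
    using leg_solE[OF leg_sol_leg_inf[OF c, folded S_def]] by metis
  obtain e1 e2 where e: "\<And>x. x \<in> ball 0 1 \<Longrightarrow> (?e has_field_derivative e1 x) (at x)"
    "\<And>x. x \<in> ball 0 1 \<Longrightarrow> (e1 has_field_derivative e2 x) (at x)"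
    "\<And>x. x \<in> ball 0 1 \<Longrightarrow> (1 - x\<^sup>2) * e2 x - (2 * a + 2 * b + 1) * x * e1 x = 4 * a * b * ?e x"
    using leg_solE[OF leg_sol_even_sol] by metis
  obtain o1 o2 where o: "\<And>x. x \<in> ball 0 1 \<Longrightarrow> (?o has_field_derivative o1 x) (at x)"
    "\<And>x. x \<in> ball 0 1 \<Longrightarrow> (o1 has_field_derivative o2 x) (at x)"
    "\<And>x. x \<in> ball 0 1 \<Longrightarrow> (1 - x\<^sup>2) * o2 x - (2 * a + 2 * b + 1) * x * o1 x = 4 * a * b * ?o x"
    using leg_solE[OF leg_sol_odd_sol] by metis
  have b0: "(0::complex) \<in> ball 0 1" by simp
  have 0: "?e 0 = 1" "?o 0 = 0" by (simp_all add: even_sol_def odd_sol_def hypF_0)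
  have sq: "((\<lambda>x. x\<^sup>2) has_field_derivative 0) (at (0::complex))"
    by (auto intro!: derivative_eq_intros)
  have hF: "((\<lambda>x. hypF a b c (x\<^sup>2)) has_field_derivative a * b / c * hypF (a + 1) (b + 1) (c + 1) (0\<^sup>2) * 0) (at 0)"
    if "c \<notin> \<int>\<^sub>\<le>\<^sub>0" for a b c
    by (rule DERIV_chain2[where g = "\<lambda>x. x\<^sup>2", OF has_field_derivative_hypF[OF that] sq]) simp
  have e10: "e1 0 = 0"
    using DERIV_unique[OF e(1)[OF b0, unfolded even_sol_def [abs_def]] hF[OF halves_notin_nonpos_Ints(1)]] by simp
  have "(?o has_field_derivative 1) (at 0)"
    unfolding odd_sol_def [abs_def]
    by (rule DERIV_cong[OF DERIV_mult[OF DERIV_ident hF[OF halves_notin_nonpos_Ints(2)]]]) (simp add: hypF_0)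
  then have o10: "o1 0 = 1" using DERIV_unique[OF o(1)[OF b0]] by blast
  define P where "P x = (1 - x\<^sup>2) powr (a + b + 1/2)" for x
  have "\<exists>K. \<forall>x\<in>ball 0 1. P x * (?e x * o1 x - e1 x * ?o x) = K"
    unfolding P_def by (rule leg_wronskian[OF convex_ball slit e o])
  then obtain K where K: "\<And>x. x \<in> ball 0 1 \<Longrightarrow> P x * (?e x * o1 x - e1 x * ?o x) = K" by blast
  \<comment> \<open>E and O have the initial data (1, 0) and (0, 1), and the weight is 1 at
    0.\<close>
  have "K = 1" using K[of 0] by (simp add: 0 e10 o10 P_def)
  have D': "x \<in> D \<Longrightarrow> x \<in> ball 0 1" "x \<in> D \<Longrightarrow> x \<in> S" for x using D by (auto simp: S_def)
  have "\<exists>K. \<forall>x\<in>D. P x * (?v x * o1 x - v1 x * ?o x) = K"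
    unfolding P_def by (rule leg_wronskian[OF D(1) slit[OF D'(1)] v[OF D'(2)] o[OF D'(1)]])
  then obtain K1 where K1: "\<And>x. x \<in> D \<Longrightarrow> P x * (?v x * o1 x - v1 x * ?o x) = K1" by blast
  have "\<exists>K. \<forall>x\<in>D. P x * (?e x * v1 x - e1 x * ?v x) = K"
    unfolding P_def by (rule leg_wronskian[OF D(1) slit[OF D'(1)] e[OF D'(1)] v[OF D'(2)]])
  then obtain K2 where K2: "\<And>x. x \<in> D \<Longrightarrow> P x * (?e x * v1 x - e1 x * ?v x) = K2" by blast
  \<comment> \<open>Cramer's rule: the weighted Wronskian of E and O is 1, so those of V with O and
    of E with V are the coordinates of V.\<close>
  have eq: "?v x = K1 * ?e x + K2 * ?o x" if "x \<in> D" for x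
  proof -
    have "P x * (?e x * o1 x - e1 x * ?o x) = 1" using K[OF D'(1)[OF that]] \<open>K = 1\<close> by simp
    then have "?v x = ?v x * (P x * (?e x * o1 x - e1 x * ?o x))" by simp
    also have "\<dots> = (P x * (?v x * o1 x - v1 x * ?o x)) * ?e x + (P x * (?e x * v1 x - e1 x * ?v x)) * ?o x"
      by (simp add: algebra_simps)
    also have "\<dots> = K1 * ?e x + K2 * ?o x" unfolding K1[OF that] K2[OF that] ..
    finally show ?thesis .
  qed
  have eq1: "v1 x = K1 * e1 x + K2 * o1 x" if "x \<in> D" for x
  proof -
    have "((\<lambda>x. K1 * ?e x + K2 * ?o x) has_field_derivative K1 * e1 x + K2 * o1 x) (at x)"
      by (intro DERIV_add DERIV_cmult e o D'(1) that)
    moreover have "((\<lambda>x. K1 * ?e x + K2 * ?o x) has_field_derivative v1 x) (at x)"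
      by (rule has_field_derivative_transform_within_open[OF v(1)[OF D'(2)[OF that]] D(2) that]) (rule eq)
    ultimately show ?thesis using DERIV_unique by blast
  qed
  \<comment> \<open>The point 0 lies on the boundary of the half-disc, so K1 and K2 are identified
    by letting i y tend to 0 in the formulas for V and its derivative.\<close>
  let ?z = "\<lambda>y::real. \<i> * of_real y"
  have zl: "(?z \<longlongrightarrow> 0) (at_right 0)" by (auto intro!: tendsto_eq_intros)
  have zD: "\<forall>\<^sub>F y in at_right 0. ?z y \<in> D"
    by (rule eventually_at_rightI[of 0 1]) (auto simp: D_def norm_mult)
  have lim: "((\<lambda>y. f (?z y)) \<longlongrightarrow> f 0) (at_right 0)" if "(f has_field_derivative f') (at 0)" for f f'
    using isCont_tendsto_compose[OF DERIV_isCont[OF that] zl] .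
  have L1: "((\<lambda>y. K1 * ?e (?z y) + K2 * ?o (?z y)) \<longlongrightarrow> K1 * ?e 0 + K2 * ?o 0) (at_right 0)"
    by (intro tendsto_intros lim[OF e(1)[OF b0]] lim[OF o(1)[OF b0]])
  have "\<forall>\<^sub>F y in at_right 0. ?v (?z y) = K1 * ?e (?z y) + K2 * ?o (?z y)"
    using zD by eventually_elim (rule eq)
  from Lim_transform_eventually[OF leg_inf_limits(1)[OF c] this]
  have L2: "((\<lambda>y. K1 * ?e (?z y) + K2 * ?o (?z y)) \<longlongrightarrow> conn_even a b) (at_right 0)"
    unfolding conn_even_def .
  have k1: "K1 = conn_even a b"
    using tendsto_unique[OF trivial_limit_at_right_real L1 L2] by (simp add: 0)
  obtain d where d: "\<And>y. y > 0 \<Longrightarrow> (?v has_field_derivative d y) (at (?z y))" "(d \<longlongrightarrow> conn_odd a b) (at_right 0)"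
    using leg_inf_limits(2)[OF c] unfolding conn_odd_def by blast
  have M1: "((\<lambda>y. K1 * e1 (?z y) + K2 * o1 (?z y)) \<longlongrightarrow> K1 * e1 0 + K2 * o1 0) (at_right 0)"
    by (intro tendsto_intros lim[OF e(2)[OF b0]] lim[OF o(2)[OF b0]])
  have "\<forall>\<^sub>F y in at_right 0. y > (0::real)" by (rule eventually_at_right_less)
  with zD have "\<forall>\<^sub>F y in at_right 0. d y = K1 * e1 (?z y) + K2 * o1 (?z y)"
  proof eventually_elim
    case (elim y)
    have "d y = v1 (?z y)" using DERIV_unique[OF d(1)[OF elim(2)] v(1)[OF D'(2)[OF elim(1)]]] .
    then show ?case using eq1[OF elim(1)] by simp
  qed
  from Lim_transform_eventually[OF d(2) this]
  have M2: "((\<lambda>y. K1 * e1 (?z y) + K2 * o1 (?z y)) \<longlongrightarrow> conn_odd a b) (at_right 0)" .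
  have k2: "K2 = conn_odd a b"
    using tendsto_unique[OF trivial_limit_at_right_real M1 M2] by (simp add: e10 o10)
  show ?thesis using eq[of x] x unfolding k1 k2 D_def by simp
qed

text \<open>The lower half-disc follows by x -> -x: V and E are even and O is odd, so only the sign
  of the last coefficient changes.\<close>

lemma leg_inf_eq:
  assumes c: "b - a + 1 \<notin> \<int>\<^sub>\<le>\<^sub>0" and x: "s = 1 \<or> s = -1" "s * Im x > 0" "norm x < 1"
  shows "leg_inf a b x = conn_even a b * even_sol a b x + of_real s * conn_odd a b * odd_sol a b x"
  using x leg_inf_eq_upper[OF c, of x] leg_inf_eq_upper[OF c, of "- x"]
  by (auto simp: leg_inf_minus even_odd_sol_minus)

section \<open>The Legendre function on the half-planes\<close>

lemma hyp2F1_commute: "hyp2F1 a b c = hyp2F1 b a c"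
  unfolding hyp2F1_def by (simp only: hypF_commute)

text \<open>The imaginary parts of 1 + z and 1 - z have opposite signs, so their arguments add up
  within (-pi, pi] and the logarithm of the product has no jump. Passing from 1 - z to z - 1 adds s
  i pi.\<close>

lemma Ln_add_Ln_half_plane:
  assumes s: "s = 1 \<or> s = -1" "s * Im z > 0"
  shows "Ln (z + 1) + Ln (z - 1) = Ln (1 - z\<^sup>2) + of_real s * \<i> * of_real pi"
proof -
  have im: "Im z \<noteq> 0" using s by auto
  have nz: "1 + z \<noteq> 0" "1 - z \<noteq> 0" using im by (auto simp: complex_eq_iff)
  have "Ln (- (1 - z)) = Ln (1 - z) + of_real s * \<i> * of_real pi"
    unfolding Ln_minus[OF nz(2)] using s by auto
  then have 1: "Ln (z - 1) = Ln (1 - z) + of_real s * \<i> * of_real pi" by simp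
  have "Im (Ln (1 + z)) + Im (Ln (1 - z)) \<in> {-pi<..pi}"
  proof (cases "s = 1")
    case True
    then have "0 < Im (1 + z)" "\<not> 0 \<le> Im (1 - z)" using s by auto
    then show ?thesis
      using Im_Ln_pos_lt[OF nz(1)] Im_Ln_pos_le[OF nz(2)] mpi_less_Im_Ln[OF nz(2)] Im_Ln_le_pi[OF nz(2)] by auto
  next
    case False
    then have "0 < Im (1 - z)" "\<not> 0 \<le> Im (1 + z)" using s by auto
    then show ?thesis
      using Im_Ln_pos_lt[OF nz(2)] Im_Ln_pos_le[OF nz(1)] mpi_less_Im_Ln[OF nz(1)] Im_Ln_le_pi[OF nz(1)] by auto
  qed
  then have "Ln ((1 + z) * (1 - z)) = Ln (1 + z) + Ln (1 - z)"
    by (intro Ln_times_simple) (use nz in auto)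
  moreover have "(1 + z) * (1 - z) = 1 - z\<^sup>2" by (simp add: algebra_simps power2_eq_square)
  ultimately show ?thesis using 1 by (simp add: add.commute)
qed

text \<open>As 1 - 1/z^2 = -(1 - z^2)/z^2, the left side has derivative 0 and is constant on the
  half-plane; the constant is read off at z = s i, where 1 - z^2 = 1 - 1/z^2 = 2.\<close>

lemma Ln_diff_half_plane:
  assumes s: "s = 1 \<or> s = -1" "s * Im z > 0"
  shows "Ln (1 - z\<^sup>2) - Ln (1 - 1 / z\<^sup>2) - 2 * Ln z = - of_real s * \<i> * of_real pi"
proof -
  define D where "D = {z. s * Im z > 0}"
  have "D = {z. Im z > 0} \<or> D = {z. Im z < 0}" using s(1) by (auto simp: D_def)
  then have "convex D" using convex_halfspace_Im_gt[of 0] convex_halfspace_Im_lt[of 0] by auto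
  have "\<exists>K. \<forall>z\<in>D. Ln (1 - z\<^sup>2) - Ln (1 - 1 / z\<^sup>2) - 2 * Ln z = K"
  proof (rule has_field_derivative_zero_constant[OF \<open>convex D\<close>])
    fix z assume "z \<in> D"
    then have im: "Im z \<noteq> 0" by (auto simp: D_def)
    have z0: "z \<noteq> 0" using im by auto
    have n: "z \<notin> \<real>\<^sub>\<le>\<^sub>0" "1 - z\<^sup>2 \<notin> \<real>\<^sub>\<le>\<^sub>0" using im one_minus_square_notin_nonpos_Reals[of z] by (auto simp: complex_nonpos_Reals_iff)
    have "Im (1 / z) \<noteq> 0" using im z0 by (simp add: Im_divide complex_eq_iff)
    then have n': "1 - 1 / z\<^sup>2 \<notin> \<real>\<^sub>\<le>\<^sub>0" using one_minus_square_notin_nonpos_Reals[of "1 / z"] by (simp add: power_divide)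
    have nz: "1 - z\<^sup>2 \<noteq> 0" "1 - 1 / z\<^sup>2 \<noteq> 0" using n n' by auto
    have "((\<lambda>z. Ln (1 - z\<^sup>2) - Ln (1 - 1 / z\<^sup>2) - 2 * Ln z) has_field_derivative
      inverse (1 - z\<^sup>2) * - (2 * z) - inverse (1 - 1 / z\<^sup>2) * (2 / z^3) - 2 * inverse z) (at z)"
    proof (intro DERIV_diff DERIV_cmult has_field_derivative_Ln n)
      have d1: "((\<lambda>z. 1 - z\<^sup>2) has_field_derivative - (2 * z)) (at z)"
        by (auto intro!: derivative_eq_intros)
      show "((\<lambda>z. Ln (1 - z\<^sup>2)) has_field_derivative inverse (1 - z\<^sup>2) * - (2 * z)) (at z)"
        by (rule DERIV_chain2[where g = "\<lambda>z. 1 - z\<^sup>2", OF has_field_derivative_Ln[OF n(2)] d1])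
      have d2: "((\<lambda>z. 1 - 1 / z\<^sup>2) has_field_derivative 2 / z^3) (at z)"
        using z0 by (auto intro!: derivative_eq_intros simp: power2_eq_square power3_eq_cube)
      show "((\<lambda>z. Ln (1 - 1 / z\<^sup>2)) has_field_derivative inverse (1 - 1 / z\<^sup>2) * (2 / z^3)) (at z)"
        by (rule DERIV_chain2[where g = "\<lambda>z. 1 - 1 / z\<^sup>2", OF has_field_derivative_Ln[OF n'] d2])
    qed
    moreover have "inverse (1 - z\<^sup>2) * - (2 * z) - inverse (1 - 1 / z\<^sup>2) * (2 / z^3) - 2 * inverse z = 0"
    proof -
      have e: "1 - 1 / z\<^sup>2 = - (1 - z\<^sup>2) / z\<^sup>2" using z0 by (simp add: field_simps)
      define u where "u = 1 - z\<^sup>2"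
      have "u \<noteq> 0" "z\<^sup>2 = 1 - u" using nz by (auto simp: u_def)
      then have "inverse u * - (2 * z) - inverse (- u / z\<^sup>2) * (2 / z^3) - 2 * inverse z = 0"
        using z0 by (simp add: field_simps power2_eq_square power3_eq_cube) algebra
      then show ?thesis unfolding e u_def .
    qed
    ultimately show "((\<lambda>z. Ln (1 - z\<^sup>2) - Ln (1 - 1 / z\<^sup>2) - 2 * Ln z) has_field_derivative 0) (at z within D)"
      using has_field_derivative_at_within by force
  qed
  then obtain K where K: "\<And>z. z \<in> D \<Longrightarrow> Ln (1 - z\<^sup>2) - Ln (1 - 1 / z\<^sup>2) - 2 * Ln z = K" by blast
  have "of_real s * \<i> \<in> D" using s(1) by (auto simp: D_def)
  from K[OF this] have "K = - of_real s * \<i> * of_real pi"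
    using s(1) by (auto simp: power_mult_distrib)
  then show ?thesis using K[of z] s(2) by (simp add: D_def)
qed

text \<open>Pfaff's transformation replaces the argument 1/z^2 by 1/(1 - z^2). The two logarithm
  identities collect the principal powers; their phases s i pi \<mu>/2 and - s i pi b add up to - s
  i pi (\<nu> + 1)/2.\<close>

lemma legendreQ_eq_leg_inf:
  assumes c: "\<nu> + 3/2 \<notin> \<int>\<^sub>\<le>\<^sub>0" and s: "s = 1 \<or> s = -1" "s * Im z > 0"
    and a: "a = (\<mu> - \<nu>) / 2" and b: "b = (\<nu> + \<mu> + 1) / 2"
  shows "legendreQ \<nu> \<mu> z = of_real (sqrt pi) * exp (\<i> * of_real pi * \<mu>) * Gamma (\<nu> + \<mu> + 1) * rGamma (\<nu> + 3/2)
     * 2 powr (- \<nu> - 1) * exp (- of_real s * \<i> * of_real pi * (\<nu> + 1) / 2)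
     * ((1 - z\<^sup>2) powr (\<mu> / 2) * leg_inf a b z)"
proof -
  have im: "Im z \<noteq> 0" using s by auto
  then have z0: "z \<noteq> 0" by auto
  have nz: "1 - z\<^sup>2 \<noteq> 0" using one_minus_square_notin_nonpos_Reals[of z] im by auto
  have nz1: "z + 1 \<noteq> 0" "z - 1 \<noteq> 0" using im by (auto simp: complex_eq_iff)
  have "Im (1 / z) \<noteq> 0" using im z0 by (simp add: Im_divide complex_eq_iff)
  then have n': "1 - 1 / z\<^sup>2 \<notin> \<real>\<^sub>\<le>\<^sub>0" using one_minus_square_notin_nonpos_Reals[of "1 / z"] by (simp add: power_divide)
  then have nz': "1 - 1 / z\<^sup>2 \<noteq> 0" by auto
  have ex: "\<nu> + 3/2 = b + (1/2 - a) + 1/2" "b - a + 1 = \<nu> + 3/2" "(\<nu> + \<mu> + 2) / 2 = b + 1/2" "\<nu> + \<mu> + 1 = 2 * b"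
    unfolding a b by (simp_all add: field_simps)
  have pf: "1 / z\<^sup>2 / (1 / z\<^sup>2 - 1) = 1 / (1 - z\<^sup>2)"
    using z0 nz by (simp add: divide_simps)
  define H where "H = hyp2F1 b (1/2 - a) (\<nu> + 3/2) (1 / (1 - z\<^sup>2))"
  have F: "hyp2F1 ((\<nu> + \<mu> + 2) / 2) ((\<nu> + \<mu> + 1) / 2) (\<nu> + 3/2) (1 / z\<^sup>2) = (1 - 1 / z\<^sup>2) powr (- b) * H"
    unfolding ex(3) b[symmetric] H_def
    using hyp2F1_pfaff[OF c ex(1), of "1 / z\<^sup>2"] n' unfolding slit_plane_iff pf by blast
  have p1: "(z + 1) powr (\<mu> / 2) * (z - 1) powr (\<mu> / 2) = exp (of_real s * \<i> * of_real pi * \<mu> / 2) * (1 - z\<^sup>2) powr (\<mu> / 2)"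
  proof -
    have "(z + 1) powr (\<mu> / 2) * (z - 1) powr (\<mu> / 2) = exp (\<mu> / 2 * (Ln (z + 1) + Ln (z - 1)))"
      using nz1 by (simp add: powr_def exp_add distrib_left)
    also have "\<dots> = exp (of_real s * \<i> * of_real pi * \<mu> / 2) * (1 - z\<^sup>2) powr (\<mu> / 2)"
      unfolding Ln_add_Ln_half_plane[OF s] using nz by (simp add: powr_def exp_add[symmetric] algebra_simps)
    finally show ?thesis .
  qed
  have p2: "(1 - 1 / z\<^sup>2) powr (- b) / z powr (2 * b) = exp (- of_real s * \<i> * of_real pi * b) * (1 - z\<^sup>2) powr (- b)"
  proof -
    have "- b * Ln (1 - 1 / z\<^sup>2) - 2 * b * Ln z = b * ((Ln (1 - z\<^sup>2) - Ln (1 - 1 / z\<^sup>2) - 2 * Ln z) - Ln (1 - z\<^sup>2))"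
      by (simp add: algebra_simps)
    also have "\<dots> = - of_real s * \<i> * of_real pi * b + - b * Ln (1 - z\<^sup>2)"
      unfolding Ln_diff_half_plane[OF s] by (simp add: algebra_simps)
    finally have "exp (- b * Ln (1 - 1 / z\<^sup>2) - 2 * b * Ln z) = exp (- of_real s * \<i> * of_real pi * b) * exp (- b * Ln (1 - z\<^sup>2))"
      by (simp only: exp_add)
    then show ?thesis using z0 nz nz' by (simp add: powr_def exp_diff)
  qed
  have e: "exp (of_real s * \<i> * of_real pi * \<mu> / 2) * exp (- of_real s * \<i> * of_real pi * b) = exp (- of_real s * \<i> * of_real pi * (\<nu> + 1) / 2)"
    unfolding exp_add[symmetric] b by (rule arg_cong[of _ _ exp]) (simp add: field_simps)
  have t: "2 powr (- \<nu> - 1) = 1 / (2::complex) powr (\<nu> + 1)"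
    using powr_minus_divide[of "2::complex" "\<nu> + 1"] by simp
  have "legendreQ \<nu> \<mu> z = of_real (sqrt pi) * exp (\<i> * of_real pi * \<mu>) * Gamma (\<nu> + \<mu> + 1) * rGamma (\<nu> + 3/2) * 2 powr (- \<nu> - 1)
    * ((z + 1) powr (\<mu> / 2) * (z - 1) powr (\<mu> / 2)) * ((1 - 1 / z\<^sup>2) powr (- b) / z powr (2 * b)) * H"
    unfolding legendreQ_def F t unfolding ex(4) by simp
  also have "\<dots> = of_real (sqrt pi) * exp (\<i> * of_real pi * \<mu>) * Gamma (\<nu> + \<mu> + 1) * rGamma (\<nu> + 3/2) * 2 powr (- \<nu> - 1)
    * (exp (of_real s * \<i> * of_real pi * \<mu> / 2) * exp (- of_real s * \<i> * of_real pi * b))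
    * ((1 - z\<^sup>2) powr (\<mu> / 2) * ((1 - z\<^sup>2) powr (- b) * H))"
    unfolding p1 p2 by (simp only: mult_ac)
  also have "(1 - z\<^sup>2) powr (- b) * H = leg_inf a b z" unfolding leg_inf_def H_def ex(2) ..
  finally show ?thesis unfolding e .
qed

section \<open>Connection coefficients\<close>

text \<open>The reciprocal form has no exceptional points: where one of the two Gamma factors has a
  pole, 2 z is a non-positive integer and both sides vanish.\<close>

lemma rGamma_legendre_duplication:
  fixes z :: complex
  shows "rGamma z * rGamma (z + 1/2) = 2 powr (2 * z - 1) / of_real (sqrt pi) * rGamma (2 * z)"
proof (cases "z \<in> \<int>\<^sub>\<le>\<^sub>0 \<or> z + 1/2 \<in> \<int>\<^sub>\<le>\<^sub>0")
  case False
  then have nz: "Gamma z \<noteq> 0" "Gamma (z + 1/2) \<noteq> 0" by (auto simp: Gamma_eq_zero_iff)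
  have "2 powr (2 * z - 1) = exp (- ((1 - 2 * z) * of_real (ln 2)))"
    by (simp add: powr_def algebra_simps Ln_of_real[of 2, simplified])
  then have "2 powr (2 * z - 1) * exp ((1 - 2 * z) * of_real (ln 2)) = 1" by (simp add: exp_minus)
  moreover have "Gamma z * Gamma (z + 1/2) = exp ((1 - 2*z) * of_real (ln 2)) * of_real (sqrt pi) * Gamma (2*z)"
    using Gamma_legendre_duplication[of z] False by simp
  moreover from this nz have "Gamma (2 * z) \<noteq> 0" by auto
  ultimately have "2 powr (2 * z - 1) / of_real (sqrt pi) * rGamma (2 * z) * (Gamma z * Gamma (z + 1/2)) = 1"
    by (simp add: rGamma_inverse_Gamma field_simps)
  then show ?thesis using nz by (simp add: rGamma_inverse_Gamma field_simps)
next
  case True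
  then have "2 * z \<in> \<int>\<^sub>\<le>\<^sub>0"
  proof
    assume "z \<in> \<int>\<^sub>\<le>\<^sub>0"
    then obtain n where "z = of_int n" "n \<le> 0" by (rule nonpos_Ints_cases)
    then have "2 * z = of_int (2 * n)" "2 * n \<le> 0" by auto
    then show ?thesis by (metis nonpos_Ints_of_int)
  next
    assume "z + 1/2 \<in> \<int>\<^sub>\<le>\<^sub>0"
    then obtain n where "z + 1/2 = of_int n" "n \<le> 0" by (rule nonpos_Ints_cases)
    then have "2 * z = of_int (2 * n - 1)" "2 * n - 1 \<le> 0" by (auto simp: field_simps)
    then show ?thesis by (metis nonpos_Ints_of_int)
  qed
  then have "rGamma (2 * z) = 0" by (simp add: rGamma_eq_zero_iff)
  moreover have "rGamma z * rGamma (z + 1/2) = 0" using True by (auto simp: rGamma_eq_zero_iff)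
  ultimately show ?thesis by simp
qed

text \<open>The reflection formula pairs \<open>rGamma a\<close> with \<open>rGamma (1 - a)\<close>
  and \<open>rGamma (b + 1/2)\<close> with \<open>rGamma (1/2 - b)\<close>. The mixed products make
  up the determinant of V and W with respect to E and O.\<close>

lemma conn_products:
  "conn_even a b * conn_odd b a = 2 * \<i> / of_real pi * (Gamma (b - a + 1) * Gamma (a - b + 1))
     * (sin (of_real pi * a) * cos (of_real pi * b))"
proof -
  have r: "rGamma a * rGamma (1 - a) = sin (of_real pi * a) / of_real pi"
    by (rule rGamma_reflection_complex)
  have "rGamma (b + 1/2) * rGamma (1/2 - b) = sin (of_real pi * (b + 1/2)) / of_real pi"
    using rGamma_reflection_complex[of "b + 1/2"] by simp
  also have "sin (of_real pi * (b + 1/2)) = cos (of_real pi * b)"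
    by (simp add: distrib_left sin_add)
  finally have r': "rGamma (b + 1/2) * rGamma (1/2 - b) = cos (of_real pi * b) / of_real pi" .
  have sp: "complex_of_real (sqrt pi) * of_real (sqrt pi) = of_real pi" by (simp flip: of_real_mult)
  have "conn_even a b * conn_odd b a = 2 * \<i> * (Gamma (b - a + 1) * Gamma (a - b + 1))
     * (complex_of_real (sqrt pi) * of_real (sqrt pi)) * (rGamma a * rGamma (1 - a)) * (rGamma (b + 1/2) * rGamma (1/2 - b))"
    unfolding conn_even_def conn_odd_def by (simp only: mult_ac)
  then show ?thesis unfolding r r' sp by simp
qed

text \<open>For the two constants of one solution the arguments pair up with difference 1/2, so the
  duplication formula applies instead of reflection.\<close>

lemma conn_product_same:
  "conn_even a b * conn_odd a b = 2 * \<i> * (Gamma (b - a + 1))\<^sup>2 * 2 powr (2 * b - 2 * a - 1) * rGamma (1 - 2 * a) * rGamma (2 * b)"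
proof -
  have 1: "rGamma (1/2 - a) * rGamma (1 - a) = 2 powr (- 2 * a) / of_real (sqrt pi) * rGamma (1 - 2 * a)"
    using rGamma_legendre_duplication[of "1/2 - a"] by (simp add: algebra_simps)
  note 2 = rGamma_legendre_duplication[of b]
  have 3: "2 powr (2 * b - 2 * a - 1) = (2::complex) powr (- 2 * a) * 2 powr (2 * b - 1)"
    by (simp add: powr_add[symmetric] algebra_simps)
  have "conn_even a b * conn_odd a b = 2 * \<i> * (Gamma (b - a + 1))\<^sup>2 * (of_real (sqrt pi))\<^sup>2
    * (rGamma (1/2 - a) * rGamma (1 - a)) * (rGamma b * rGamma (b + 1/2))"
    unfolding conn_even_def conn_odd_def power2_eq_square by (simp only: mult_ac)
  then show ?thesis unfolding 1 2 3 by (simp add: power2_eq_square field_simps)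
qed

text \<open>The left side is V continued across (-1, 1) from the opposite half-disc. Linear algebra
  expresses it through V and W; the determinant A B' - A' B is a multiple of sin(pi (a - b)),
  nonzero because a - b is no integer.\<close>

lemma leg_inf_reflect:
  assumes ab: "a - b \<notin> \<int>" and x: "s = 1 \<or> s = -1" "s * Im x > 0" "norm x < 1"
  shows "conn_even a b * even_sol a b x - of_real s * conn_odd a b * odd_sol a b x =
    sin (of_real pi * (a + b)) / sin (of_real pi * (a - b)) * leg_inf a b x
    - of_real pi ^ 2 * 2 powr (2 * b - 2 * a) * Gamma (b - a + 1) * rGamma (a - b + 1) * rGamma (1 - 2 * a) * rGamma (2 * b)
      / (of_real pi * sin (of_real pi * (a - b))) * leg_inf b a x"
proof -
  have nn: "b - a + 1 \<notin> \<int>\<^sub>\<le>\<^sub>0" "a - b + 1 \<notin> \<int>\<^sub>\<le>\<^sub>0"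
  proof -
    have "a - b \<in> \<int>" if "b - a + 1 \<in> \<int> \<or> a - b + 1 \<in> \<int>"
      using that Ints_diff[of 1 "b - a + 1"] Ints_diff[of "a - b + 1" 1] by auto
    then show "b - a + 1 \<notin> \<int>\<^sub>\<le>\<^sub>0" "a - b + 1 \<notin> \<int>\<^sub>\<le>\<^sub>0" using ab nonpos_Ints_Int by blast+
  qed
  define A B A' B' where "A = conn_even a b" and "B = conn_odd a b" and "A' = conn_even b a" and "B' = conn_odd b a"
  define e o' where "e = even_sol a b x" and "o' = of_real s * odd_sol a b x"
  define G1 G2 where "G1 = Gamma (b - a + 1)" and "G2 = Gamma (a - b + 1)"
  define S D where "S = sin (of_real pi * (a + b))" and "D = sin (of_real pi * (a - b))"
  have G: "G1 \<noteq> 0" "G2 \<noteq> 0" using nn by (auto simp: G1_def G2_def Gamma_eq_zero_iff)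
  have D0: "D \<noteq> 0"
  proof
    assume "D = 0"
    then obtain n where "of_real pi * (a - b) = of_real (of_int n * pi)"
      unfolding D_def sin_eq_0 by (auto simp: mult.commute)
    then have "a - b = of_int n" by (simp add: mult.commute)
    then show False using ab by simp
  qed
  have p1: "A * B' = 2 * \<i> / of_real pi * (G1 * G2) * (sin (of_real pi * a) * cos (of_real pi * b))"
    unfolding A_def B'_def G1_def G2_def by (rule conn_products)
  have p2: "A' * B = 2 * \<i> / of_real pi * (G1 * G2) * (sin (of_real pi * b) * cos (of_real pi * a))"
    unfolding A'_def B_def G1_def G2_def using conn_products[of b a] by (simp only: mult_ac)
  have dd: "A * B' - A' * B = 2 * \<i> / of_real pi * (G1 * G2) * D"
    unfolding p1 p2 D_def right_diff_distrib sin_diff by (simp add: algebra_simps)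
  have ss: "A * B' + A' * B = 2 * \<i> / of_real pi * (G1 * G2) * S"
    unfolding p1 p2 S_def distrib_left sin_add by (simp add: algebra_simps)
  have v: "leg_inf a b x = A * e + B * o'" "leg_inf b a x = A' * e + B' * o'"
    unfolding A_def B_def A'_def B'_def e_def o'_def
    using leg_inf_eq[OF nn(1) x] leg_inf_eq[OF nn(2) x] even_odd_sol_commute[of a b] by (simp_all add: mult_ac)
  have pi0: "complex_of_real pi \<noteq> 0" by simp
  \<comment> \<open>The coefficient A B' + A' B of V carries sin(pi (a + b)), while W receives the
    product A B evaluated by duplication.\<close>
  have "(A * B' - A' * B) * (A * e - B * o') = (A * B' + A' * B) * (A * e + B * o') - 2 * (A * B) * (A' * e + B' * o')"
    by (simp add: algebra_simps)
  then have "2 * \<i> / of_real pi * (G1 * G2) * D * (A * e - B * o') =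
     2 * \<i> / of_real pi * (G1 * G2) * S * leg_inf a b x - 2 * (A * B) * leg_inf b a x"
    unfolding dd ss v .
  moreover have "2 * \<i> / of_real pi * (G1 * G2) * D \<noteq> 0" using G D0 by simp
  ultimately have "A * e - B * o' = (2 * \<i> / of_real pi * (G1 * G2) * S * leg_inf a b x - 2 * (A * B) * leg_inf b a x)
     / (2 * \<i> / of_real pi * (G1 * G2) * D)"
    by (metis nonzero_mult_div_cancel_left)
  also have "\<dots> = S / D * leg_inf a b x - (A * B) * of_real pi / (\<i> * (G1 * G2) * D) * leg_inf b a x"
    using G D0 by (simp add: divide_simps)
  also have "(A * B) * of_real pi / (\<i> * (G1 * G2) * D) = of_real pi ^ 2 * 2 powr (2 * b - 2 * a) * G1 * rGamma (a - b + 1) * rGamma (1 - 2 * a) * rGamma (2 * b)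
      / (of_real pi * D)"
  proof -
    have "2 powr (2 * b - 2 * a) = 2 * 2 powr (2 * b - 2 * a - 1 :: complex)"
      using powr_add[of "2::complex" 1 "2 * b - 2 * a - 1"] by simp
    moreover have "rGamma (a - b + 1) = 1 / G2" by (simp add: G2_def rGamma_inverse_Gamma inverse_eq_divide)
    ultimately show ?thesis
      unfolding A_def B_def conn_product_same G1_def[symmetric] using G D0 pi0
      by (simp add: divide_simps power2_eq_square)
  qed
  finally show ?thesis unfolding A_def B_def e_def o'_def S_def D_def G1_def by (simp only: mult_ac)
qed

section \<open>The Ferrers function\<close>

text \<open>The sign s = 1 or s = -1 selects the upper or the lower half-plane, so that both cases
  of the theorem share one argument.\<close>

definition half_plane :: "real \<Rightarrow> complex set" where "half_plane s = {z. s * Im z > 0}"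

lemma open_half_plane: "open (half_plane s)"
  unfolding half_plane_def by (intro open_Collect_less continuous_intros)

text \<open>The boundary value is that of a function continuous at x which agrees with f on the
  half-disc. Since \<open>Lim\<close> is a definite description, uniqueness must be secured by x
  being a limit point of the half-plane.\<close>

lemma Lim_half_plane:
  assumes s: "s = 1 \<or> s = -1" and x: "Im x = 0" "norm x < 1"
    and f: "\<And>z. s * Im z > 0 \<Longrightarrow> norm z < 1 \<Longrightarrow> f z = g z" and g: "isCont g x"
  shows "Lim (at x within half_plane s) f = g x"
proof (rule tendsto_Lim)
  have "x islimpt half_plane s"
    unfolding islimpt_approachable
  proof (intro allI impI)
    fix e :: real assume e: "e > 0"
    have "s * s = 1" using s by auto
    then show "\<exists>x'\<in>half_plane s. x' \<noteq> x \<and> dist x' x < e"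
      using e s x by (intro bexI[of _ "x + of_real (s * e / 2) * \<i>"]) (auto simp: half_plane_def dist_norm norm_mult)
  qed
  then show "at x within half_plane s \<noteq> bot" by (simp add: trivial_limit_within)
  have "(g \<longlongrightarrow> g x) (at x within half_plane s)"
    using g by (simp add: isCont_def tendsto_within_subset[of _ _ _ UNIV])
  moreover have "\<forall>\<^sub>F z in at x within half_plane s. g z = f z"
  proof -
    have "\<forall>\<^sub>F z in at x within half_plane s. z \<in> ball 0 1 \<inter> half_plane s"
      using x by (intro eventually_at_topological[THEN iffD2] exI[of _ "ball 0 1"]) auto
    then show ?thesis by eventually_elim (use f in \<open>auto simp: half_plane_def\<close>)
  qed
  ultimately show "(f \<longlongrightarrow> g x) (at x within half_plane s)"
    by (rule Lim_transform_eventually)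
qed

text \<open>The continuation is glued along this cover: on the disc it is given by E and O, on the
  half-planes by V and W.\<close>

lemma D1_eq: "D1 = ball 0 1 \<union> half_plane 1 \<union> half_plane (-1)"
proof (intro equalityI subsetI)
  fix z assume z: "z \<in> D1"
  show "z \<in> ball 0 1 \<union> half_plane 1 \<union> half_plane (-1)"
  proof (cases "Im z = 0")
    case True
    then have "z = of_real (Re z)" by (simp add: complex_eq_iff)
    moreover have "\<not> (Re z \<le> -1 \<or> Re z \<ge> 1)"
    proof
      assume "Re z \<le> -1 \<or> Re z \<ge> 1"
      then have "of_real (Re z) \<in> complex_of_real ` ({..-1} \<union> {1..})" by (intro imageI) auto
      then show False using z \<open>z = of_real (Re z)\<close> by (simp add: D1_def)
    qed
    then have "\<bar>Re z\<bar> < 1" by auto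
    ultimately show ?thesis by (metis UnI1 dist_0_norm mem_ball norm_of_real)
  qed (auto simp: half_plane_def)
next
  fix z assume "z \<in> ball 0 1 \<union> half_plane 1 \<union> half_plane (-1)"
  then show "z \<in> D1" by (auto simp: D1_def half_plane_def)
qed

lemma D1_topology: "open D1" "connected D1" "complex_of_real ` {-1<..<1} \<subseteq> D1" "0 \<in> D1"
  "0 islimpt complex_of_real ` {-1<..<1}"
proof -
  show "open D1" unfolding D1_eq by (intro open_Un open_half_plane open_ball)
  have c: "connected (half_plane s)" for s
  proof -
    have "convex (half_plane s)"
    proof (rule convexI)
      fix x y :: complex and u v :: real
      assume h: "x \<in> half_plane s" "y \<in> half_plane s" "0 \<le> u" "0 \<le> v" "u + v = 1"
      have "u * (s * Im x) + v * (s * Im y) > 0"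
      proof (cases "u = 0")
        case False
        then have "u * (s * Im x) > 0" "v * (s * Im y) \<ge> 0" using h by (auto simp: half_plane_def)
        then show ?thesis by linarith
      qed (use h in \<open>auto simp: half_plane_def\<close>)
      then show "u *\<^sub>R x + v *\<^sub>R y \<in> half_plane s" by (simp add: half_plane_def algebra_simps)
    qed
    then show ?thesis by (rule convex_connected)
  qed
  have i: "ball 0 1 \<inter> half_plane 1 \<noteq> {}" "(ball 0 1 \<union> half_plane 1) \<inter> half_plane (-1) \<noteq> {}"
  proof -
    have "\<i> / 2 \<in> ball 0 1 \<inter> half_plane 1" by (simp add: half_plane_def)
    then show "ball 0 1 \<inter> half_plane 1 \<noteq> {}" by blast
    have "- (\<i> / 2) \<in> ball 0 1 \<inter> half_plane (-1)" by (simp add: half_plane_def)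
    then show "(ball 0 1 \<union> half_plane 1) \<inter> half_plane (-1) \<noteq> {}" by blast
  qed
  show "connected D1" unfolding D1_eq
    by (intro connected_Un c i connected_ball)
  show "complex_of_real ` {-1<..<1} \<subseteq> D1" unfolding D1_eq by auto
  show "0 \<in> D1" unfolding D1_eq by simp
  show "0 islimpt complex_of_real ` {-1<..<1}"
    unfolding islimpt_approachable
  proof (intro allI impI)
    fix e :: real assume e: "e > 0"
    define t where "t = min (e / 2) (1/2)"
    have t: "t > 0" "t < e" "t < 1" using e by (auto simp: t_def)
    then show "\<exists>x'\<in>complex_of_real ` {-1<..<1}. x' \<noteq> 0 \<and> dist x' 0 < e"
      by (intro bexI[of _ "of_real t"]) auto
  qed
qed

theorem theorem4p2:
  fixes \<nu> \<mu> x :: complex and s :: real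
  assumes "\<nu> + \<mu> \<notin> (\<lambda>n::nat. - of_nat n) ` {1..}"
    and "\<nu> + 1/2 \<notin> \<int>"
    and "s = 1 \<and> Im x > 0 \<or> s = -1 \<and> Im x < 0"
  shows "ferrersQ \<nu> \<mu> x =
      of_real (sqrt pi) * 2 powr (- \<nu> - 1)
        * exp (of_real s * (1/2) * \<i> * of_real pi * (- \<nu> + \<mu> - 1))
        * (cos (of_real pi * \<mu>)
           - of_real s * \<i> * (sin (of_real pi * (\<mu> - \<nu>)) / (2 * cos (of_real pi * \<nu>))))
        * (Gamma (\<nu> + \<mu> + 1) * rGamma (\<nu> + 3/2))
        * (1 - x\<^sup>2) powr (- (1/2) * \<nu> - 1/2)
        * hyp2F1 ((\<nu> - \<mu> + 1) / 2) ((\<nu> + \<mu> + 1) / 2) (\<nu> + 3/2) (1 / (1 - x\<^sup>2))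
    + of_real (pi powr (3/2)) * 2 powr (\<nu> - 1)
        * (exp (of_real s * (1/2) * \<i> * of_real pi * (\<nu> + \<mu> + 1)) * (1 / cos (of_real pi * \<nu>))
           * rGamma (\<nu> - \<mu> + 1) * rGamma (1/2 - \<nu>))
        * (1 - x\<^sup>2) powr ((1/2) * \<nu>)
        * hyp2F1 (- ((\<nu> + \<mu>) / 2)) ((\<mu> - \<nu>) / 2) (1/2 - \<nu>) (1 / (1 - x\<^sup>2))"
proof -
  define a b where "a = (\<mu> - \<nu>) / 2" and "b = (\<nu> + \<mu> + 1) / 2"
  have ab: "a - b = - (\<nu> + 1/2)" "a + b = \<mu> + 1/2" "b - a + 1 = \<nu> + 3/2" "a - b + 1 = 1/2 - \<nu>"
    "2 * b = \<nu> + \<mu> + 1" "1 - 2 * a = \<nu> - \<mu> + 1" "2 * b - 2 * a = 2 * \<nu> + 1"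
    unfolding a_def b_def by (simp_all add: field_simps)
  have abZ: "a - b \<notin> \<int>" unfolding ab using assms(2) by (metis minus_in_Ints_iff)
  have "\<nu> + 1/2 \<in> \<int>" if "\<nu> + 3/2 \<in> \<int> \<or> 1/2 - \<nu> \<in> \<int>"
    using that Ints_diff[of "\<nu> + 3/2" 1] Ints_diff[of 1 "1/2 - \<nu>"] by (auto simp: algebra_simps)
  then have nn: "\<nu> + 3/2 \<notin> \<int>\<^sub>\<le>\<^sub>0" "1/2 - \<nu> \<notin> \<int>\<^sub>\<le>\<^sub>0" using assms(2) nonpos_Ints_Int by blast+
  \<comment> \<open>This lets the factor \<open>Gamma (\<nu> + \<mu> + 1)\<close> of Q cancel
    against \<open>rGamma (2 * b)\<close>, which enters through \<open>\<beta>\<close>.\<close>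
  have "\<nu> + \<mu> + 1 \<notin> \<int>\<^sub>\<le>\<^sub>0"
  proof
    assume "\<nu> + \<mu> + 1 \<in> \<int>\<^sub>\<le>\<^sub>0"
    then obtain n where "\<nu> + \<mu> + 1 = - of_nat n" by (rule nonpos_Ints_cases')
    then have "\<nu> + \<mu> = - of_nat (Suc n)" by (simp add: algebra_simps eq_neg_iff_add_eq_0)
    moreover have "Suc n \<in> {1..}" by simp
    ultimately show False using assms(1) by blast
  qed
  then have GG: "Gamma (\<nu> + \<mu> + 1) * rGamma (\<nu> + \<mu> + 1) = 1" by (simp add: rGamma_inverse_Gamma Gamma_eq_zero_iff)
  define K where "K = of_real (sqrt pi) * Gamma (\<nu> + \<mu> + 1) * rGamma (\<nu> + 3/2) * 2 powr (- \<nu> - 1)"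
  define P where "P z = (1 - z\<^sup>2) powr (\<mu> / 2)" for z :: complex
  \<comment> \<open>\<open>C t\<close> belongs to the boundary value from side t: the factor 1/2 and
    the phase of \<open>ferrersQ_interval\<close> times the constant of
    \<open>legendreQ_eq_leg_inf\<close>.\<close>
  define C :: "real \<Rightarrow> complex" where "C t = 1/2 * K * exp (- of_real t * \<i> * of_real pi * (\<nu> + \<mu> + 1) / 2)" for t
  define \<alpha> where "\<alpha> = sin (of_real pi * (a + b)) / sin (of_real pi * (a - b))"
  define \<beta> where "\<beta> = - (of_real pi ^ 2 * 2 powr (2 * b - 2 * a) * Gamma (b - a + 1) * rGamma (a - b + 1) * rGamma (1 - 2 * a) * rGamma (2 * b)
      / (of_real pi * sin (of_real pi * (a - b))))"
  have sn: "sin (of_real pi * (a - b)) = - cos (of_real pi * \<nu>)" "sin (of_real pi * (a + b)) = cos (of_real pi * \<mu>)"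
    unfolding ab by (simp_all add: distrib_left sin_add sin_diff right_diff_distrib)
  have cos0: "cos (of_real pi * \<nu>) \<noteq> 0"
  proof
    assume "cos (of_real pi * \<nu>) = 0"
    then have "sin (of_real pi * (\<nu> + 1/2)) = 0" by (simp add: distrib_left sin_add)
    then obtain n where "of_real pi * (\<nu> + 1/2) = of_real (of_int n * pi)"
      unfolding sin_eq_0 by (auto simp: mult.commute)
    then have "\<nu> + 1/2 = of_int n" by (simp add: mult.commute)
    then show False using assms(2) by simp
  qed
  have \<alpha>_eq: "\<alpha> = - cos (of_real pi * \<mu>) / cos (of_real pi * \<nu>)" unfolding \<alpha>_def sn by simp
  have \<beta>_eq: "\<beta> = of_real pi * 2 powr (2 * \<nu> + 1) * Gamma (\<nu> + 3/2) * rGamma (1/2 - \<nu>) * rGamma (\<nu> - \<mu> + 1) * rGamma (\<nu> + \<mu> + 1)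
      / cos (of_real pi * \<nu>)"
    unfolding \<beta>_def sn unfolding ab(7) unfolding ab using cos0 by (simp add: power2_eq_square)
  define V where "V = leg_inf a b"
  define W where "W = leg_inf b a"
  \<comment> \<open>\<open>U t\<close> equals V on the half-disc of sign t but is holomorphic on the
    whole disc; on that half-disc \<open>U (- t)\<close> is \<alpha> V + \<beta> W. Hence
    \<open>g0\<close> continues the Ferrers function to the disc and \<open>G t\<close> to the
    half-plane t, with the contribution of the opposite side rewritten.\<close>
  define U where "U t z = conn_even a b * even_sol a b z + of_real t * conn_odd a b * odd_sol a b z" for t :: real and z
  define g0 where "g0 z = P z * (C 1 * U 1 z + C (-1) * U (-1) z)" for z
  define G where "G t z = P z * ((C t + C (- t) * \<alpha>) * V z + C (- t) * \<beta> * W z)" for t z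
  have VU: "V z = U t z" "U (- t) z = \<alpha> * V z + \<beta> * W z"
    if t: "t = 1 \<or> t = -1" and z: "t * Im z > 0" "norm z < 1" for t z
  proof -
    show "V z = U t z" unfolding V_def U_def using leg_inf_eq[OF _ t z, of b a] nn ab by simp
    show "U (- t) z = \<alpha> * V z + \<beta> * W z"
      using leg_inf_reflect[OF abZ t z] unfolding U_def \<alpha>_def \<beta>_def V_def W_def by simp
  qed
  have g0G: "g0 z = G t z" if t: "t = 1 \<or> t = -1" and z: "t * Im z > 0" "norm z < 1" for t z
  proof -
    have "g0 z = P z * (C t * U t z + C (- t) * U (- t) z)"
      using t by (auto simp: g0_def add.commute)
    also have "\<dots> = G t z" unfolding VU[OF t z, symmetric] unfolding VU(2)[OF t z] G_def
      by (simp add: algebra_simps)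
    finally show ?thesis .
  qed
  have Phol: "P holomorphic_on {z. 1 - z\<^sup>2 \<notin> \<real>\<^sub>\<le>\<^sub>0}"
    unfolding P_def by (intro holomorphic_intros) auto
  have leg_hol: "v holomorphic_on S" if "leg_sol a b S v" for a b S v
    using that unfolding leg_sol_def holomorphic_on_def
    by (meson field_differentiable_at_within field_differentiable_def)
  have U_hol: "U t holomorphic_on ball 0 1" for t
    unfolding U_def by (intro holomorphic_intros leg_hol[OF leg_sol_even_sol] leg_hol[OF leg_sol_odd_sol])
  have Pball: "P holomorphic_on ball 0 1"
    by (rule holomorphic_on_subset[OF Phol]) (use one_minus_square_notin_nonpos_Reals in auto)
  have g0_hol: "g0 holomorphic_on ball 0 1"
    unfolding g0_def by (intro holomorphic_intros Pball U_hol)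
  have G_hol: "G t holomorphic_on half_plane t" for t
  proof -
    have sub: "half_plane t \<subseteq> {z. Im z \<noteq> 0}" by (auto simp: half_plane_def)
    have "V holomorphic_on half_plane t" "W holomorphic_on half_plane t"
      unfolding V_def W_def using holomorphic_on_subset[OF leg_hol[OF leg_sol_leg_inf] sub] nn ab by auto
    moreover have "P holomorphic_on half_plane t"
      by (rule holomorphic_on_subset[OF Phol]) (use one_minus_square_notin_nonpos_Reals sub in auto)
    ultimately show ?thesis unfolding G_def by (intro holomorphic_intros)
  qed
  \<comment> \<open>At real points outside the disc the sign is 0 and the value arbitrary; these
    points are not in \<open>D1\<close>.\<close>
  define g where "g z = (if norm z < 1 then g0 z else G (sgn (Im z)) z)" for z
  have gG: "g z = G t z" if "t = 1 \<or> t = -1" "t * Im z > 0" for t z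
  proof -
    have "sgn (Im z) = t" using that by (auto simp: sgn_if)
    then show ?thesis using g0G[OF that] by (simp add: g_def)
  qed
  have g_hol: "g holomorphic_on D1"
    unfolding D1_eq
  proof (intro holomorphic_on_Un open_Un open_half_plane open_ball)
    show "g holomorphic_on ball 0 1"
      by (rule holomorphic_transform[OF g0_hol]) (simp add: g_def)
    have "g holomorphic_on half_plane t" if "t = 1 \<or> t = -1" for t
      by (rule holomorphic_transform[OF G_hol]) (simp add: gG[OF that] half_plane_def)
    then show "g holomorphic_on half_plane 1" "g holomorphic_on half_plane (-1)" by simp_all
  qed
  define L :: "real \<Rightarrow> complex" where "L t = K * exp (\<i> * of_real pi * \<mu>) * exp (- of_real t * \<i> * of_real pi * (\<nu> + 1) / 2)" for t
  have Qlim: "Lim (at w within half_plane t) (legendreQ \<nu> \<mu>) = L t * (P w * U t w)"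
    if t: "t = 1 \<or> t = -1" and w: "Im w = 0" "norm w < 1" for t w
  proof (rule Lim_half_plane[OF t w])
    fix z assume z: "t * Im z > 0" "norm z < 1"
    show "legendreQ \<nu> \<mu> z = L t * (P z * U t z)"
      unfolding legendreQ_eq_leg_inf[OF nn(1) t z(1) a_def b_def] VU(1)[OF t z, unfolded V_def, symmetric] L_def K_def P_def
      by (simp only: mult_ac)
  next
    have "(\<lambda>z. L t * (P z * U t z)) holomorphic_on ball 0 1"
      by (intro holomorphic_intros Pball U_hol)
    then show "isCont (\<lambda>z. L t * (P z * U t z)) w"
      using w by (intro continuous_on_interior[OF holomorphic_on_imp_continuous_on]) auto
  qed
  have hp: "half_plane 1 = {z. Im z > 0}" "half_plane (-1) = {z. Im z < 0}"
    by (auto simp: half_plane_def)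
  \<comment> \<open>After inserting the boundary values of Q from \<open>Qlim\<close>, agreement
    with \<open>g0\<close> amounts to comparing phases in \<open>C 1\<close> and
    \<open>C (-1)\<close>.\<close>
  have int: "g w = ferrersQ_interval \<nu> \<mu> w" if "w \<in> complex_of_real ` {-1<..<1}" for w
  proof -
    have w: "Im w = 0" "norm w < 1" using that by auto
    have c1: "C 1 = 1/2 * (exp (- (\<i> * of_real pi * \<mu> / 2)) * exp (- (\<i> * of_real pi * \<mu>)) * L 1)"
    proof -
      have "exp (- of_real 1 * \<i> * of_real pi * (\<nu> + \<mu> + 1) / 2) =
        exp (- (\<i> * of_real pi * \<mu> / 2)) * exp (- (\<i> * of_real pi * \<mu>)) * exp (\<i> * of_real pi * \<mu>) * exp (- of_real 1 * \<i> * of_real pi * (\<nu> + 1) / 2)"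
        unfolding exp_add[symmetric] by (rule arg_cong[of _ _ exp]) (simp add: field_simps)
      then show ?thesis unfolding C_def L_def by (simp only: mult_ac)
    qed
    have c2: "C (-1) = 1/2 * (exp (\<i> * of_real pi * \<mu> / 2) * exp (- (\<i> * of_real pi * \<mu>)) * L (-1))"
    proof -
      have "exp (- of_real (-1) * \<i> * of_real pi * (\<nu> + \<mu> + 1) / 2) =
        exp (\<i> * of_real pi * \<mu> / 2) * exp (- (\<i> * of_real pi * \<mu>)) * exp (\<i> * of_real pi * \<mu>) * exp (- of_real (-1) * \<i> * of_real pi * (\<nu> + 1) / 2)"
        unfolding exp_add[symmetric] by (rule arg_cong[of _ _ exp]) (simp add: field_simps)
      then show ?thesis unfolding C_def L_def by (simp only: mult_ac)
    qed
    have "ferrersQ_interval \<nu> \<mu> w = 1/2 * (exp (- (\<i> * of_real pi * \<mu> / 2)) * exp (- (\<i> * of_real pi * \<mu>)) * (L 1 * (P w * U 1 w))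
       + exp (\<i> * of_real pi * \<mu> / 2) * exp (- (\<i> * of_real pi * \<mu>)) * (L (-1) * (P w * U (-1) w)))"
      unfolding ferrersQ_interval_def lim_upper_def lim_lower_def hp[symmetric] using Qlim[OF _ w] by simp
    also have "\<dots> = g0 w" unfolding g0_def c1 c2 by (simp add: algebra_simps)
    finally show ?thesis using w by (simp add: g_def)
  qed
  have s: "s = 1 \<or> s = -1" "s * Im x > 0" using assms(3) by auto
  have xD: "x \<in> D1" using s by (auto simp: D1_eq half_plane_def)
  have "ferrersQ \<nu> \<mu> x = g x"
    unfolding ferrersQ_def by (rule analytic_ext_eqI[OF g_hol int D1_topology(1-4) D1_topology(5) xD])
  also have "\<dots> = G s x" by (rule gG[OF s])
  also have "\<dots> = (C s + C (- s) * \<alpha>) * (P x * V x) + C (- s) * \<beta> * (P x * W x)"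
    unfolding G_def by (simp add: algebra_simps)
  also have "P x * V x = (1 - x\<^sup>2) powr (- (1/2) * \<nu> - 1/2)
        * hyp2F1 ((\<nu> - \<mu> + 1) / 2) ((\<nu> + \<mu> + 1) / 2) (\<nu> + 3/2) (1 / (1 - x\<^sup>2))"
  proof -
    have e: "\<mu> / 2 + - b = - (1/2) * \<nu> - 1/2" "1/2 - a = (\<nu> - \<mu> + 1) / 2" by (simp_all add: a_def b_def field_simps)
    show ?thesis unfolding P_def V_def leg_inf_def mult.assoc[symmetric] powr_add[symmetric] e ab(3) b_def[symmetric]
      by (subst hyp2F1_commute) (rule refl)
  qed
  also have "P x * W x = (1 - x\<^sup>2) powr ((1/2) * \<nu>)
        * hyp2F1 (- ((\<nu> + \<mu>) / 2)) ((\<mu> - \<nu>) / 2) (1/2 - \<nu>) (1 / (1 - x\<^sup>2))"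
  proof -
    have e: "\<mu> / 2 + - a = (1/2) * \<nu>" "1/2 - b = - ((\<nu> + \<mu>) / 2)" by (simp_all add: a_def b_def field_simps)
    show ?thesis unfolding P_def W_def leg_inf_def mult.assoc[symmetric] powr_add[symmetric] e ab(4) a_def[symmetric]
      by (subst hyp2F1_commute) (rule refl)
  qed
  also have "C s + C (- s) * \<alpha> = of_real (sqrt pi) * 2 powr (- \<nu> - 1)
        * exp (of_real s * (1/2) * \<i> * of_real pi * (- \<nu> + \<mu> - 1))
        * (cos (of_real pi * \<mu>)
           - of_real s * \<i> * (sin (of_real pi * (\<mu> - \<nu>)) / (2 * cos (of_real pi * \<nu>))))
        * (Gamma (\<nu> + \<mu> + 1) * rGamma (\<nu> + 3/2))"
  proof -
    \<comment> \<open>Z is the phase in the first term of the claim. Relative to it the two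
      coefficients have the phases exp(- s i pi \<mu>) and - exp(s i pi \<nu>); by Euler's formula
      and the subtraction formula for the sine they combine to the bracket.\<close>
    define Z where "Z = exp (of_real s * (1/2) * \<i> * of_real pi * (- \<nu> + \<mu> - 1))"
    have euler: "exp (of_real s * \<i> * z) = cos z + of_real s * \<i> * sin z" for z
      using s(1) exp_Euler[of z] exp_minus_Euler[of z] by auto
    have e1: "exp (- of_real s * \<i> * of_real pi * (\<nu> + \<mu> + 1) / 2) = Z * (cos (of_real pi * \<mu>) - of_real s * \<i> * sin (of_real pi * \<mu>))"
    proof -
      have "exp (- of_real s * \<i> * of_real pi * (\<nu> + \<mu> + 1) / 2) = Z * exp (of_real s * \<i> * (- (of_real pi * \<mu>)))"
        unfolding Z_def exp_add[symmetric] by (rule arg_cong[of _ _ exp]) (simp add: field_simps)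
      then show ?thesis unfolding euler by simp
    qed
    have e2: "exp (- of_real (- s) * \<i> * of_real pi * (\<nu> + \<mu> + 1) / 2) = - Z * (cos (of_real pi * \<nu>) + of_real s * \<i> * sin (of_real pi * \<nu>))"
    proof -
      have "exp (- of_real (- s) * \<i> * of_real pi * (\<nu> + \<mu> + 1) / 2) = Z * exp (of_real s * \<i> * (of_real pi * \<nu> + of_real pi))"
        unfolding Z_def exp_add[symmetric] by (rule arg_cong[of _ _ exp]) (simp add: field_simps)
      then show ?thesis unfolding euler sin_add cos_add by (simp add: algebra_simps)
    qed
    have "C s + C (- s) * \<alpha> = K * Z * (cos (of_real pi * \<mu>) - of_real s * \<i> * (sin (of_real pi * (\<mu> - \<nu>)) / (2 * cos (of_real pi * \<nu>))))"
      unfolding C_def e1 e2 \<alpha>_eq right_diff_distrib[of _ \<mu> \<nu>] sin_diff using cos0 by (simp add: field_simps)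
    then show ?thesis unfolding K_def Z_def[symmetric] by (simp only: mult_ac)
  qed
  also have "C (- s) * \<beta> = of_real (pi powr (3/2)) * 2 powr (\<nu> - 1)
        * (exp (of_real s * (1/2) * \<i> * of_real pi * (\<nu> + \<mu> + 1)) * (1 / cos (of_real pi * \<nu>))
           * rGamma (\<nu> - \<mu> + 1) * rGamma (1/2 - \<nu>))"
  proof -
    have e: "exp (- of_real (- s) * \<i> * of_real pi * (\<nu> + \<mu> + 1) / 2) = exp (of_real s * (1/2) * \<i> * of_real pi * (\<nu> + \<mu> + 1))"
      by (rule arg_cong[of _ _ exp]) simp
    have "pi powr (3/2) = pi * sqrt pi"
      using powr_add[of pi 1 "1/2"] by (simp add: powr_half_sqrt)
    then have p: "complex_of_real (pi powr (3/2)) = of_real pi * of_real (sqrt pi)" by simp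
    have "2 powr (- \<nu> - 1) * 2 powr (2 * \<nu> + 1) = 2 * (2::complex) powr (\<nu> - 1)"
      using powr_add[of "2::complex" "- \<nu> - 1" "2 * \<nu> + 1"] powr_add[of "2::complex" 1 "\<nu> - 1"] by simp
    note pw = this
    have g: "rGamma (\<nu> + 3/2) * Gamma (\<nu> + 3/2) = 1" using nn(1) by (simp add: rGamma_inverse_Gamma Gamma_eq_zero_iff)
    \<comment> \<open>Factors are grouped so that they cancel: the powers of 2 give 2 * 2^(\<nu> -
      1), whose factor 2 meets the 1/2 of \<open>C\<close>, and both Gamma products are 1.\<close>
    have "C (- s) * \<beta> = 1/2 * (2 powr (- \<nu> - 1) * 2 powr (2 * \<nu> + 1)) * (rGamma (\<nu> + 3/2) * Gamma (\<nu> + 3/2))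
      * (Gamma (\<nu> + \<mu> + 1) * rGamma (\<nu> + \<mu> + 1)) * (of_real pi * of_real (sqrt pi))
      * exp (of_real s * (1/2) * \<i> * of_real pi * (\<nu> + \<mu> + 1)) * (1 / cos (of_real pi * \<nu>))
           * rGamma (\<nu> - \<mu> + 1) * rGamma (1/2 - \<nu>)"
      unfolding C_def e \<beta>_eq K_def using cos0 by (simp add: divide_simps)
    then show ?thesis unfolding pw g GG p by simp
  qed
  finally show ?thesis by (simp only: mult.assoc)
qed

end
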